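(* Let $(X,Y)$ be a random vector in $\mathbb{R}^{d_x}\times\mathbb{R}^{d_y}$ with law $\nu$, $\mathbb{E}[\|X\|^2+\|Y\|^2]<\infty$ and $\mathbb{E}[X]=0$; let $\mu$ be a Borel probability measure on $\mathbb{R}^{d_y}$ with finite second moment, and let $\varepsilon>0$. Assume: (A1) the matrix $\mathbb{E}[XX^\top]$ is invertible; (A2) the mapping $Q\mapsto \mathsf{KL}(Q\,\|\,\tilde R)$ is coercive in $\tilde{\mathsf W}_1$, i.e. for every $0<a<\infty$ the set $\{Q\in\tilde{\mathcal P}_1:\mathsf{KL}(Q\,\|\,\tilde R)\le a\}$ is compact for the $\tilde{\mathsf W}_1$-topology. Then the following hold. (i) (Strong duality) $\mathsf T^\varepsilon(\mu,\nu)=\mathsf D^\varepsilon(\mu,\nu)$. (ii) (Dual attainment) There exist functions $(f^\varepsilon,g^\varepsilon,h^\varepsilon)\in L^1(\mu)\times L^1(\mu;\mathbb{R}^{d_x})\times L^1(\nu)$ such that the unique optimal solution $\pi^\varepsilon$ of the primal problem satisfies $$\frac{d\pi^\varepsilon}{dR}(u,x,y)=e^{\frac1\varepsilon\left(f^\varepsilon(u)+\langle g^\varepsilon(u),x\rangle+h^\varepsilon(x,y)-c(u,y)\right)} \quad R\text{-a.e.}$$ These functions are optimal for the dual problem, i.e. $D^\varepsilon(f^\varepsilon,g^\varepsilon,h^\varepsilon)=\mathsf D^\varepsilon(\mu,\nu)$. Finally, $$\mathsf T^\varepsilon(\mu,\nu)=\int f^\varepsilon\,d\mu+\int h^\varepsilon\,d\nu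 .$$
   Context: Points of $\mathbb{R}^{d_y}\times\mathbb{R}^{d_x+d_y}$ are written $(u,x,y)$ with $u,y\in\mathbb{R}^{d_y}$, $x\in\mathbb{R}^{d_x}$. $c(u,y):=\frac12\|u-y\|^2$ and $R:=\mu\otimes\nu$. $\Pi(\mu,\nu)$ is the set of couplings of $\mu$ and $\nu$ (Borel probability measures on $\mathbb{R}^{d_y}\times\mathbb{R}^{d_x+d_y}$ with marginals $\mu,\nu$). For $\pi\in\Pi(\mu,\nu)$, $\pi_u$ denotes the conditional law of $(\tilde X,\tilde Y)$ given $U=u$ when $(U,\tilde X,\tilde Y)\sim\pi$. $\mathsf{KL}(P\|Q)=\int\log\frac{dP}{dQ}\,dP$ if $P\ll Q$ and $=\infty$ otherwise. Primal problem: $$\mathsf T^\varepsilon(\mu,\nu):=\inf_{\pi}\Big(\int c\,d\pi+\varepsilon\,\mathsf{KL}(\pi\|\mu\otimes\nu)\Big),$$ the infimum being over $\pi\in\Pi(\mu,\nu)$ with $\int x\,d\pi_u(x,y)=0$ for $\mu$-a.e. $u$. It has a unique optimal solution, denoted $\pi^\varepsilon$. Dual problem: $\mathsf D^\varepsilon(\mu,\nu):=\sup D^\varepsilon(f,g,h)$ over $(f,g,h)\in L^1(\mu)\times L^1(\mu;\mathbb{R}^{d_x})\times L^1(\nu)$, where $$D^\varepsilon(f,g,h):=\int f\,d\mu+\int h\,d\nu-\varepsilon\int e^{\frac1\varepsilon(f(u)+\langle g(u),x\rangle+h(x,y)-c(u,y))}\,dR(u,x,y)+\varepsilon\in[-\infty,\infty).$$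 $\tilde R$ is the probability measure $d\tilde R:=\alpha^{-1}e^{-c/\varepsilon}\,dR$ with $\alpha:=\int e^{-c/\varepsilon}\,dR\in(0,\infty)$. The metric $\tilde{\mathsf d}$ on $\mathbb{R}^{d_y}\times\mathbb{R}^{d_x+d_y}$ is $\tilde{\mathsf d}((u,x,y),(u',x',y')):=\min\{\|u-u'\|,1\}+\|x-x'\|+\min\{\|y-y'\|,1\}$; $\tilde{\mathcal P}_1$ is the set of Borel probability measures $P$ on this space with $\int\tilde{\mathsf d}(\cdot,0)\,dP<\infty$; and $\tilde{\mathsf W}_1(P,Q):=\inf_{\gamma\in\Pi(P,Q)}\int\tilde{\mathsf d}\,d\gamma$ is the corresponding $1$-Wasserstein metric on $\tilde{\mathcal P}_1$. *)

theory Defs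
  imports "HOL-Probability.Probability"
begin

section \<open>Couplings, conditional laws, relative entropy\<close>

definition couplings ::
  "'a::second_countable_topology measure \<Rightarrow> 'b::second_countable_topology measure
    \<Rightarrow> ('a \<times> 'b) measure set" where
  "couplings P Q =
    {\<pi>. prob_space \<pi> \<and> sets \<pi> = sets borel \<and> distr \<pi> borel fst = P \<and> distr \<pi> borel snd = Q}"

text \<open>\<open>K u\<close> is the conditional law \<open>\<pi>\<^sub>u\<close> of the second component given that the first
  one equals \<open>u\<close>. Such a kernel is unique up to a null set of the first marginal.\<close>

definition is_conditional_law ::
  "('a::second_countable_topology \<times> 'b::second_countable_topology) measure
    \<Rightarrow> ('a \<Rightarrow> 'b measure) \<Rightarrow> bool" where
  "is_conditional_law \<pi> K \<longleftrightarrow>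
    K \<in> borel \<rightarrow>\<^sub>M prob_algebra borel \<and>
    (\<forall>A\<in>sets borel. \<forall>B\<in>sets borel.
      emeasure \<pi> (A \<times> B) = (\<integral>\<^sup>+u\<in>A. emeasure (K u) B \<partial>distr \<pi> borel fst))"

text \<open>The library's real-valued \<^const>\<open>KL_divergence\<close> \<open>b Q P\<close> is the integral of
  \<open>log b (dP/dQ)\<close> with respect to \<open>P\<close>. The negative part of this integrand is always
  integrable for probability measures, so non-integrability means that the integral is
  \<open>+\<infinity>\<close>. Note that the library function takes the reference measure first.\<close>

definition KL :: "'a measure \<Rightarrow> 'a measure \<Rightarrow> ereal" where
  "KL P Q =
    (if absolutely_continuous Q P \<and> integrable P (entropy_density (exp 1) Q P)
     then ereal (KL_divergence (exp 1) Q P) else \<infinity>)"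

section \<open>Primal and dual problem\<close>

definition cost :: "'u::real_normed_vector \<Rightarrow> 'u \<Rightarrow> real" where
  "cost u y = (norm (u - y))\<^sup>2 / 2"

definition feasible ::
  "'u::euclidean_space measure \<Rightarrow> ('x::euclidean_space \<times> 'u) measure
    \<Rightarrow> ('u \<times> 'x \<times> 'u) measure set" where
  "feasible \<mu> \<nu> =
    {\<pi> \<in> couplings \<mu> \<nu>. \<exists>K. is_conditional_law \<pi> K \<and>
       (AE u in \<mu>. integrable (K u) fst \<and> (\<integral>(x, y). x \<partial>K u) = 0)}"

definition primal_objective ::
  "real \<Rightarrow> 'u::euclidean_space measure \<Rightarrow> ('x::euclidean_space \<times> 'u) measure
    \<Rightarrow> ('u \<times> 'x \<times> 'u) measure \<Rightarrow> ereal" where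
  "primal_objective \<epsilon> \<mu> \<nu> \<pi> =
    enn2ereal (\<integral>\<^sup>+(u, x, y). ennreal (cost u y) \<partial>\<pi>) + ereal \<epsilon> * KL \<pi> (\<mu> \<Otimes>\<^sub>M \<nu>)"

definition primal_value ::
  "real \<Rightarrow> 'u::euclidean_space measure \<Rightarrow> ('x::euclidean_space \<times> 'u) measure \<Rightarrow> ereal" where
  "primal_value \<epsilon> \<mu> \<nu> = (INF \<pi>\<in>feasible \<mu> \<nu>. primal_objective \<epsilon> \<mu> \<nu> \<pi>)"

definition primal_solutions ::
  "real \<Rightarrow> 'u::euclidean_space measure \<Rightarrow> ('x::euclidean_space \<times> 'u) measure
    \<Rightarrow> ('u \<times> 'x \<times> 'u) measure set" where
  "primal_solutions \<epsilon> \<mu> \<nu> =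
    {\<pi> \<in> feasible \<mu> \<nu>. primal_objective \<epsilon> \<mu> \<nu> \<pi> = primal_value \<epsilon> \<mu> \<nu>}"

definition gibbs_density ::
  "real \<Rightarrow> ('u \<Rightarrow> real) \<Rightarrow> ('u \<Rightarrow> 'x) \<Rightarrow> ('x \<times> 'u \<Rightarrow> real)
    \<Rightarrow> 'u::euclidean_space \<times> 'x::euclidean_space \<times> 'u \<Rightarrow> real" where
  "gibbs_density \<epsilon> f g h = (\<lambda>(u, x, y). exp ((f u + g u \<bullet> x + h (x, y) - cost u y) / \<epsilon>))"

definition dual_objective ::
  "real \<Rightarrow> 'u::euclidean_space measure \<Rightarrow> ('x::euclidean_space \<times> 'u) measure
    \<Rightarrow> ('u \<Rightarrow> real) \<Rightarrow> ('u \<Rightarrow> 'x) \<Rightarrow> ('x \<times> 'u \<Rightarrow> real) \<Rightarrow> ereal" where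
  "dual_objective \<epsilon> \<mu> \<nu> f g h =
    ereal ((\<integral>u. f u \<partial>\<mu>) + (\<integral>z. h z \<partial>\<nu>))
    - ereal \<epsilon> * enn2ereal (\<integral>\<^sup>+w. ennreal (gibbs_density \<epsilon> f g h w) \<partial>(\<mu> \<Otimes>\<^sub>M \<nu>))
    + ereal \<epsilon>"

definition dual_value ::
  "real \<Rightarrow> 'u::euclidean_space measure \<Rightarrow> ('x::euclidean_space \<times> 'u) measure \<Rightarrow> ereal" where
  "dual_value \<epsilon> \<mu> \<nu> =
    (SUP (f, g, h)\<in>{(f, g, h). integrable \<mu> f \<and> integrable \<mu> g \<and> integrable \<nu> h}.
       dual_objective \<epsilon> \<mu> \<nu> f g h)"

section \<open>The tilted reference measure and the modified Wasserstein metric\<close>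

definition tilted_measure ::
  "real \<Rightarrow> 'u::euclidean_space measure \<Rightarrow> ('x::euclidean_space \<times> 'u) measure
    \<Rightarrow> ('u \<times> 'x \<times> 'u) measure" where
  "tilted_measure \<epsilon> \<mu> \<nu> =
    (let R = \<mu> \<Otimes>\<^sub>M \<nu>; \<alpha> = (\<integral>(u, x, y). exp (- cost u y / \<epsilon>) \<partial>R)
     in density R (\<lambda>(u, x, y). ennreal (exp (- cost u y / \<epsilon>) / \<alpha>)))"

definition dist_t ::
  "'u::euclidean_space \<times> 'x::euclidean_space \<times> 'u \<Rightarrow> 'u \<times> 'x \<times> 'u \<Rightarrow> real" where
  "dist_t = (\<lambda>(u, x, y) (u', x', y').
     min (norm (u - u')) 1 + norm (x - x') + min (norm (y - y')) 1)"

definition P1_t :: "('u::euclidean_space \<times> 'x::euclidean_space \<times> 'u) measure set" where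
  "P1_t = {P. prob_space P \<and> sets P = sets borel \<and> (\<integral>\<^sup>+w. ennreal (dist_t w 0) \<partial>P) < \<infinity>}"

text \<open>On \<open>P1_t\<close> the infimum is finite, so that \<^const>\<open>enn2real\<close> does not truncate anything.\<close>

definition W1_t ::
  "('u::euclidean_space \<times> 'x::euclidean_space \<times> 'u) measure
    \<Rightarrow> ('u \<times> 'x \<times> 'u) measure \<Rightarrow> real" where
  "W1_t P Q =
    enn2real (INF \<gamma>\<in>couplings P Q. \<integral>\<^sup>+(v, w). ennreal (dist_t v w) \<partial>\<gamma>)"

text \<open>The topology of the metric space \<open>(P1_t, W1_t)\<close>. It is spelled out because the library
  describes \<^const>\<open>Metric_space.mtopology\<close> only once the metric axioms have been proved.\<close>

definition W1_t_topology ::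
  "('u::euclidean_space \<times> 'x::euclidean_space \<times> 'u) measure topology" where
  "W1_t_topology =
    topology (\<lambda>U. U \<subseteq> P1_t \<and> (\<forall>P\<in>U. \<exists>r>0. {Q \<in> P1_t. W1_t P Q < r} \<subseteq> U))"

lemma openin_W1_t_topology:
  "openin W1_t_topology U \<longleftrightarrow> U \<subseteq> P1_t \<and> (\<forall>P\<in>U. \<exists>r>0. {Q \<in> P1_t. W1_t P Q < r} \<subseteq> U)"
  (is "_ \<longleftrightarrow> ?op U")
proof -
  have "?op (S \<inter> T)" if S: "?op S" and T: "?op T" for S T
  proof (intro conjI ballI)
    fix P assume "P \<in> S \<inter> T"
    with S T obtain r s where "r > 0" "{Q \<in> P1_t. W1_t P Q < r} \<subseteq> S"
      "s > 0" "{Q \<in> P1_t. W1_t P Q < s} \<subseteq> T" by blast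
    then show "\<exists>r>0. {Q \<in> P1_t. W1_t P Q < r} \<subseteq> S \<inter> T"
      by (intro exI[of _ "min r s"]) auto
  qed (use S in blast)
  moreover have "?op (\<Union>\<K>)" if "\<forall>K\<in>\<K>. ?op K" for \<K>
  proof (intro conjI ballI)
    fix P assume "P \<in> \<Union>\<K>"
    with that obtain K r where "K \<in> \<K>" "r > 0" "{Q \<in> P1_t. W1_t P Q < r} \<subseteq> K" by blast
    then show "\<exists>r>0. {Q \<in> P1_t. W1_t P Q < r} \<subseteq> \<Union>\<K>" by blast
  qed (use that in blast)
  ultimately have "istopology ?op"
    unfolding istopology_def by (intro conjI allI impI) iprover+
  then show ?thesis
    by (simp only: W1_t_topology_def topology_inverse')
qed

lemma W1_t_topology_eq_mtopology:
  defines "\<P> \<equiv> P1_t :: ('u::euclidean_space \<times> 'x::euclidean_space \<times> 'u) measure set"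
  assumes "Metric_space \<P> W1_t"
  shows "W1_t_topology = Metric_space.mtopology \<P> W1_t"
  unfolding topology_eq openin_W1_t_topology Metric_space.openin_mtopology[OF assms(2)]
    Metric_space.mball_def[OF assms(2)]
  unfolding \<P>_def by blast

definition KL_coercive ::
  "('u::euclidean_space \<times> 'x::euclidean_space \<times> 'u) measure \<Rightarrow> bool" where
  "KL_coercive P \<longleftrightarrow>
    (\<forall>a::real. 0 < a \<longrightarrow> compactin W1_t_topology {Q \<in> P1_t. KL Q P \<le> ereal a})"

end

theory Submission
  imports Defs
begin

text \<open>
  Write \<open>R\<close> for the product measure and \<open>t = (f(u) + g(u) \<bullet> x + h(x, y) - c(u, y)) / \<epsilon>\<close> for the
  exponent of the Gibbs density with respect to \<open>R\<close>. Up to a positive factor and an additive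
  constant, the dual problem is to minimise \<open>\<integral> exp t - t \<partial>R\<close> over integrable potentials. Everything
  follows from solving this problem first.

  Existence (\<open>exists_minimiser\<close>). The exponents form an affine space, and the identity
  \<open>(exp (a/2) - exp (b/2))\<^sup>2 = exp a + exp b - 2 exp ((a + b)/2)\<close> makes \<open>exp (t/2)\<close> Cauchy in \<open>L\<^sup>2\<close>
  along a minimising sequence. A subsequence of exponents thus converges almost everywhere, and by
  Fatou's lemma and \<open>\<bar>t\<bar> \<le> 2 (exp t - t)\<close> to an integrable function of minimal value. As \<open>R\<close> is a
  product measure and the vectors \<open>(1, x)\<close> span the whole space on every set of full measure, the
  limit again has the form above, with each potential integrable (\<open>potentials_closed\<close>).

  First-order conditions (\<open>gibbs_measure_feasible\<close>). Decreasing the exponent by a nonnegative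
  direction \<open>v = a(u) + b(u) \<bullet> x + k(x, y)\<close> never harms integrability, so that
  \<open>\<integral> v exp t \<partial>R \<le> \<integral> v \<partial>R\<close> for all these \<open>v\<close>. Indicator functions give the marginals of the measure with
  density \<open>exp t\<close>. For the martingale condition, \<open>v\<close> is \<open>\<bar>b\<bar> \<bar>x\<bar> \<plusminus> b \<bullet> x\<close> with \<open>u\<close> restricted to a Borel
  set in the second summand; the term \<open>\<bar>b\<bar> \<bar>x\<bar>\<close> cancels because the marginal is already known, so that
  no exponential moments of \<open>x\<close> are needed.

  Duality (\<open>weak_duality_KL\<close>). For a feasible \<open>\<pi>\<close> of finite entropy with density \<open>D\<close>, the inequality
  \<open>y \<le> exp y - 1\<close> for \<open>y = t - ln D\<close>, integrated with respect to \<open>\<pi>\<close>, is weak duality, and its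
  equality case is uniqueness. The point to check is \<open>\<integral> g(u) \<bullet> x \<partial>\<pi> = 0\<close>, where a one-sided bound
  suffices (\<open>martingale_integral\<close>). For the Gibbs measure of the minimiser both objectives
  equal \<open>\<integral> f \<partial>\<mu> + \<integral> h \<partial>\<nu>\<close>.
\<close>

section \<open>Minimising the integral of \<open>exp t - t\<close>\<close>

lemma abs_le_two_exp_minus_self: "\<bar>t\<bar> \<le> 2 * (exp t - t)" for t :: real
proof (cases "0 \<le> t")
  case True
  then have "1 + t + t\<^sup>2 / 2 \<le> exp t"
    by (rule exp_lower_Taylor_quadratic)
  moreover have "0 \<le> (t - 1)\<^sup>2" by simp
  ultimately show ?thesis
    using True by (simp add: power2_eq_square algebra_simps)
next
  case False
  then show ?thesis
    using exp_gt_zero[of t] by (simp del: exp_gt_zero)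
qed

lemma exp_minus_self_nonneg: "0 \<le> exp t - t" for t :: real
  using exp_ge_add_one_self[of t] by (simp del: exp_ge_add_one_self)

text \<open>Strong midpoint convexity of \<open>exp t - t\<close>: the convexity gap is half the squared difference of
  the values of \<open>exp (t / 2)\<close>.\<close>

lemma exp_half_parallelogram:
  "(exp (a/2) - exp (b/2))\<^sup>2 / 2
     = ((exp a - a) + (exp b - b)) / 2 - (exp ((a + b)/2) - (a + b)/2)" for a b :: real
proof -
  have "(exp (a/2) - exp (b/2))\<^sup>2 = (exp (a/2))\<^sup>2 + (exp (b/2))\<^sup>2 - 2 * (exp (a/2) * exp (b/2))"
    by (simp add: power2_eq_square algebra_simps)
  also have "\<dots> = exp a + exp b - 2 * exp ((a + b)/2)"
    by (simp add: exp_double[symmetric] exp_add[symmetric] add_divide_distrib)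
  finally show ?thesis by (simp add: field_simps)
qed

lemma tendsto_of_exp_half:
  fixes s :: "nat \<Rightarrow> real"
  assumes lim: "(\<lambda>n. exp (s n / 2)) \<longlonglongrightarrow> w"
    and fin: "liminf (\<lambda>n. ennreal (exp (s n) - s n)) < \<infinity>"
  shows "convergent s"
proof -
  have "0 \<le> w"
    by (rule LIMSEQ_le_const[OF lim]) (auto intro!: exI[of _ 0])
  moreover have "w \<noteq> 0"
  proof
    assume "w = 0"
    obtain C where C: "0 \<le> C" "liminf (\<lambda>n. ennreal (exp (s n) - s n)) = ennreal C"
      using fin by (cases "liminf (\<lambda>n. ennreal (exp (s n) - s n))") auto
    have "\<forall>\<^sub>F n in sequentially. exp (s n / 2) < exp (- (C + 1) / 2)"
      using lim \<open>w = 0\<close> by (intro order_tendstoD) auto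
    then have "\<forall>\<^sub>F n in sequentially. ennreal (C + 1) \<le> ennreal (exp (s n) - s n)"
    proof eventually_elim
      case (elim n)
      then have "C + 1 \<le> exp (s n) - s n"
        using exp_gt_zero[of "s n"] by (simp del: exp_gt_zero)
      then show ?case by (rule ennreal_leI)
    qed
    then have "ennreal (C + 1) \<le> ennreal C"
      unfolding C(2)[symmetric] by (rule Liminf_bounded)
    with C(1) show False by simp
  qed
  ultimately have "(\<lambda>n. 2 * ln (exp (s n / 2))) \<longlonglongrightarrow> 2 * ln w"
    using lim by (intro tendsto_intros) auto
  then show ?thesis by (auto simp: convergent_def)
qed

lemma (in prob_space) integral_abs_less_of_square:
  fixes d :: "'a \<Rightarrow> real"
  assumes "integrable M d" "integrable M (\<lambda>x. (d x)\<^sup>2)" "(\<integral>x. (d x)\<^sup>2 \<partial>M) < e\<^sup>2" "0 < e"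
  shows "(\<integral>x. \<bar>d x\<bar> \<partial>M) < e"
proof -
  have "(\<integral>x. \<bar>d x\<bar> \<partial>M) \<le> (\<integral>x. e / 2 + (d x)\<^sup>2 / (2 * e) \<partial>M)"
  proof (rule integral_mono)
    fix x
    have "0 \<le> (\<bar>d x\<bar> - e)\<^sup>2" by simp
    then show "\<bar>d x\<bar> \<le> e / 2 + (d x)\<^sup>2 / (2 * e)"
      using \<open>0 < e\<close> by (simp add: power2_eq_square field_simps abs_mult_self)
  qed (use assms in auto)
  also have "\<dots> = e / 2 + (\<integral>x. (d x)\<^sup>2 \<partial>M) / (2 * e)"
    using assms by (simp add: prob_space)
  also have "\<dots> < e / 2 + e\<^sup>2 / (2 * e)"
    using assms by (intro add_strict_left_mono divide_strict_right_mono) auto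
  also have "\<dots> = e" using \<open>0 < e\<close> by (simp add: power2_eq_square)
  finally show ?thesis .
qed

text \<open>By the parallelogram identity, the functions \<open>exp (t / 2)\<close> of a minimising sequence are Cauchy
  in \<open>L\<^sup>2\<close>, so that a subsequence of the \<open>t\<close> converges almost everywhere in the extended reals.
  Fatou's lemma excludes the limit \<open>-\<infinity>\<close> and shows that the limit is a minimiser; no compactness is
  needed.\<close>

lemma (in prob_space) exists_minimiser_exp_minus_self:
  fixes T :: "('a \<Rightarrow> real) set"
  assumes t0: "t0 \<in> T" "integrable M (\<lambda>x. exp (t0 x))"
    and int: "\<And>t. t \<in> T \<Longrightarrow> integrable M t"
    and mid: "\<And>a b. a \<in> T \<Longrightarrow> b \<in> T \<Longrightarrow> (\<lambda>x. (a x + b x) / 2) \<in> T"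
    and closed: "\<And>s t. (\<And>n. s n \<in> T) \<Longrightarrow> AE x in M. (\<lambda>n::nat. s n x) \<longlonglongrightarrow> t x \<Longrightarrow>
      integrable M t \<Longrightarrow> \<exists>t'\<in>T. AE x in M. t x = t' x"
  obtains t where "t \<in> T" "integrable M (\<lambda>x. exp (t x))"
    "\<And>s. s \<in> T \<Longrightarrow> integrable M (\<lambda>x. exp (s x)) \<Longrightarrow>
      (\<integral>x. exp (t x) - t x \<partial>M) \<le> (\<integral>x. exp (s x) - s x \<partial>M)"
proof -
  define S where "S = {t \<in> T. integrable M (\<lambda>x. exp (t x))}"
  define J where "J t = (\<integral>x. exp (t x) - t x \<partial>M)" for t :: "'a \<Rightarrow> real"
  define m where "m = Inf (J ` S)"
  have intS: "integrable M t" "integrable M (\<lambda>x. exp (t x))" if "t \<in> S" for t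
    using that int by (auto simp: S_def)
  have J_nonneg: "0 \<le> J t" for t
    unfolding J_def by (rule Bochner_Integration.integral_nonneg) (rule exp_minus_self_nonneg)
  have bdd: "bdd_below (J ` S)"
    using J_nonneg by (auto intro!: bdd_belowI[of _ 0])
  have m_le: "m \<le> J t" if "t \<in> S" for t
    unfolding m_def using that bdd by (auto intro: cInf_lower)
  have midS: "(\<lambda>x. (a x + b x) / 2) \<in> S" if "a \<in> S" "b \<in> S" for a b
  proof -
    have [measurable]: "a \<in> borel_measurable M" "b \<in> borel_measurable M"
      using that intS by auto
    have "integrable M (\<lambda>x. exp ((a x + b x) / 2))"
    proof (rule Bochner_Integration.integrable_bound)
      show "integrable M (\<lambda>x. (exp (a x) + exp (b x)) / 2)"
        using that intS by auto
      have "exp ((a x + b x) / 2) \<le> (exp (a x) + exp (b x)) / 2" for x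
        using exp_half_parallelogram[of "a x" "b x"] zero_le_power2[of "exp (a x/2) - exp (b x/2)"]
        by (simp only: diff_divide_distrib add_divide_distrib)
      then show "AE x in M. norm (exp ((a x + b x) / 2)) \<le> norm ((exp (a x) + exp (b x)) / 2)"
        by (intro AE_I2) (smt (verit) exp_gt_zero real_norm_def)
    qed measurable
    then show ?thesis
      using that mid by (auto simp: S_def)
  qed
  have square: "integrable M (\<lambda>x. (exp (a x / 2) - exp (b x / 2))\<^sup>2)"
      "(\<integral>x. (exp (a x / 2) - exp (b x / 2))\<^sup>2 \<partial>M) \<le> J a + J b - 2 * m"
    if "a \<in> S" "b \<in> S" for a b
  proof -
    have eq: "(exp (a x / 2) - exp (b x / 2))\<^sup>2 = (exp (a x) - a x) + (exp (b x) - b x)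
        - 2 * (exp ((a x + b x)/2) - (a x + b x)/2)" for x
      using exp_half_parallelogram[of "a x" "b x"] by (simp add: field_simps)
    show "integrable M (\<lambda>x. (exp (a x / 2) - exp (b x / 2))\<^sup>2)"
      unfolding eq using that midS[OF that] intS
      by (intro Bochner_Integration.integrable_diff Bochner_Integration.integrable_add
        integrable_mult_right) auto
    have "(\<integral>x. (exp (a x / 2) - exp (b x / 2))\<^sup>2 \<partial>M)
      = J a + J b - 2 * J (\<lambda>x. (a x + b x) / 2)"
      unfolding eq J_def using intS[OF that(1)] intS[OF that(2)] intS[OF midS[OF that]]
      by (subst Bochner_Integration.integral_diff Bochner_Integration.integral_add; simp)+
    then show "(\<integral>x. (exp (a x / 2) - exp (b x / 2))\<^sup>2 \<partial>M) \<le> J a + J b - 2 * m"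
      using m_le[OF midS[OF that]] by simp
  qed
  have "\<exists>s\<in>S. J s < m + 1 / real (Suc n)" for n
  proof -
    have "J ` S \<noteq> {}" using t0 by (auto simp: S_def)
    then have "\<exists>y\<in>J ` S. y < m + 1 / real (Suc n)"
      unfolding m_def by (intro cInf_lessD) auto
    then show ?thesis by auto
  qed
  then obtain s where s: "\<And>n. s n \<in> S" "\<And>n. J (s n) < m + 1 / real (Suc n)"
    by metis
  have s_meas[measurable]: "s n \<in> borel_measurable M" for n
    using intS[OF s(1)] by auto
  have int_half: "integrable M (\<lambda>x. exp (s n x / 2))" for n
  proof (rule Bochner_Integration.integrable_bound)
    show "integrable M (\<lambda>x. 1 + exp (s n x))"
      using intS[OF s(1)] by auto
    have "exp (s n x / 2) \<le> 1 + exp (s n x)" for x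
      by (cases "s n x \<le> 0") (auto intro: add_increasing add_increasing2)
    then show "AE x in M. norm (exp (s n x / 2)) \<le> norm (1 + exp (s n x))"
      by (intro AE_I2) (smt (verit) exp_gt_zero real_norm_def)
  qed measurable
  obtain r where r: "strict_mono r" "AE x in M. Cauchy (\<lambda>i. exp (s (r i) x / 2))"
  proof (rule cauchy_L1_AE_cauchy_subseq[where s = "\<lambda>n x. exp (s n x / 2)", OF int_half])
    fix e :: real assume "0 < e"
    obtain N where N: "1 / real (Suc N) < e\<^sup>2 / 2"
      using nat_approx_posE[of "e\<^sup>2 / 2"] \<open>0 < e\<close> by auto
    show "\<exists>N. \<forall>i\<ge>N. \<forall>j\<ge>N. (\<integral>x. norm (exp (s i x / 2) - exp (s j x / 2)) \<partial>M) < e"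
    proof (intro exI allI impI)
      fix i j assume ij: "N \<le> i" "N \<le> j"
      have *: "1 / real (Suc k) \<le> 1 / real (Suc N)" if "N \<le> k" for k
        using that by (intro divide_left_mono) auto
      have "(\<integral>x. (exp (s i x / 2) - exp (s j x / 2))\<^sup>2 \<partial>M) \<le> J (s i) + J (s j) - 2 * m"
        using s by (intro square)
      also have "\<dots> < e\<^sup>2"
        using s(2)[of i] s(2)[of j] *[OF ij(1)] *[OF ij(2)] N by linarith
      finally show "(\<integral>x. norm (exp (s i x / 2) - exp (s j x / 2)) \<partial>M) < e"
        unfolding real_norm_def using \<open>0 < e\<close> int_half s
        by (intro integral_abs_less_of_square square) auto
    qed
  qed auto
  define t where "t x = lim (\<lambda>i. s (r i) x)" for x
  have [measurable]: "t \<in> borel_measurable M"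
    unfolding t_def by measurable
  define u where "u i x = ennreal (exp (s (r i) x) - s (r i) x)" for i x
  have u_meas[measurable]: "u i \<in> borel_measurable M" for i
    unfolding u_def by measurable
  have nn_u: "(\<integral>\<^sup>+x. u i x \<partial>M) = ennreal (J (s (r i)))" for i
    unfolding u_def J_def
    by (rule nn_integral_eq_integral)
       (use intS[OF s(1)] exp_minus_self_nonneg in auto)
  have J_lim: "(\<lambda>i. J (s (r i))) \<longlonglongrightarrow> m"
  proof (rule tendsto_sandwich[of "\<lambda>_. m" _ _ "\<lambda>i. m + 1 / real (Suc (r i))"])
    have "(\<lambda>i. m + 1 / real (Suc i)) \<longlonglongrightarrow> m + 0"
      by (intro tendsto_add tendsto_const LIMSEQ_Suc lim_inverse_n'[unfolded])
    then show "(\<lambda>i. m + 1 / real (Suc (r i))) \<longlonglongrightarrow> m"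
      using LIMSEQ_subseq_LIMSEQ[OF _ r(1)] by (fastforce simp: o_def)
  qed (use s m_le in \<open>auto intro!: always_eventually less_imp_le\<close>)
  have fatou: "(\<integral>\<^sup>+x. liminf (\<lambda>i. u i x) \<partial>M) \<le> ennreal m"
  proof -
    have "(\<integral>\<^sup>+x. liminf (\<lambda>i. u i x) \<partial>M) \<le> liminf (\<lambda>i. \<integral>\<^sup>+x. u i x \<partial>M)"
      by (rule nn_integral_liminf) measurable
    also have "\<dots> = ennreal m"
      unfolding nn_u using J_lim by (intro lim_imp_Liminf tendsto_ennrealI) auto
    finally show ?thesis .
  qed
  have "(\<integral>\<^sup>+x. liminf (\<lambda>i. u i x) \<partial>M) \<noteq> \<infinity>"
    using fatou by (auto simp: top_unique)
  then have "AE x in M. liminf (\<lambda>i. u i x) \<noteq> \<infinity>"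
    by (intro nn_integral_PInf_AE) measurable
  with r(2) have lim_t: "AE x in M. (\<lambda>i. s (r i) x) \<longlonglongrightarrow> t x"
  proof eventually_elim
    case (elim x)
    then obtain w where "(\<lambda>i. exp (s (r i) x / 2)) \<longlonglongrightarrow> w"
      by (auto simp: Cauchy_convergent_iff convergent_def)
    then show ?case
      unfolding t_def convergent_LIMSEQ_iff[symmetric]
      using elim by (intro tendsto_of_exp_half[of _ w]) (auto simp: u_def less_top)
  qed
  have nn_t: "(\<integral>\<^sup>+x. ennreal (exp (t x) - t x) \<partial>M) \<le> ennreal m"
  proof -
    have "AE x in M. ennreal (exp (t x) - t x) = liminf (\<lambda>i. u i x)"
      using lim_t
    proof eventually_elim
      case (elim x)
      then show ?case
        unfolding u_def by (intro lim_imp_Liminf[symmetric] tendsto_ennrealI tendsto_intros) auto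
    qed
    then show ?thesis
      using fatou by (subst nn_integral_cong_AE) auto
  qed
  have int_J: "integrable M (\<lambda>x. exp (t x) - t x)"
    using nn_t exp_minus_self_nonneg
    by (intro integrableI_nonneg) (auto simp: less_top[symmetric] top_unique)
  have int_t: "integrable M t"
  proof (rule Bochner_Integration.integrable_bound)
    show "integrable M (\<lambda>x. 2 * (exp (t x) - t x))"
      using int_J by (rule integrable_mult_right)
    show "AE x in M. norm (t x) \<le> norm (2 * (exp (t x) - t x))"
      using abs_le_two_exp_minus_self by (intro AE_I2) (simp only: real_norm_def, rule order_trans[OF _ abs_ge_self])
  qed measurable
  from closed[of "\<lambda>i. s (r i)" t] lim_t int_t s(1)
  obtain t' where t': "t' \<in> T" "AE x in M. t x = t' x"
    by (auto simp: S_def)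
  have [measurable]: "t' \<in> borel_measurable M"
    using int[OF t'(1)] by auto
  have "integrable M (\<lambda>x. exp (t x))"
    using Bochner_Integration.integrable_add[OF int_J int_t] by simp
  then have int_t': "integrable M (\<lambda>x. exp (t' x))"
    by (rule integrable_cong_AE_imp) (use t'(2) in auto)
  have "J t' = J t"
    unfolding J_def by (rule integral_cong_AE) (use t'(2) in auto)
  also have "J t \<le> m"
  proof -
    have "0 \<le> m"
      unfolding m_def using t0 J_nonneg by (intro cInf_greatest) (auto simp: S_def)
    moreover have "ennreal (J t) \<le> ennreal m"
      using nn_t unfolding J_def
      by (subst nn_integral_eq_integral[symmetric])
         (use int_J exp_minus_self_nonneg in auto)
    ultimately show ?thesis by simp
  qed
  finally have "J t' \<le> m" .
  with m_le have "J t' \<le> J s" if "s \<in> T" "integrable M (\<lambda>x. exp (s x))" for s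
    using that by (fastforce simp: S_def)
  with t'(1) int_t' show ?thesis
    by (auto intro!: that simp: J_def)
qed

text \<open>A perturbation \<open>t - \<delta> v\<close> with \<open>v \<ge> 0\<close> keeps \<open>exp t\<close> integrable, so that one-sided derivatives
  in such directions exist without any exponential integrability of \<open>v\<close>.\<close>

lemma (in prob_space) minimiser_variational_inequality:
  fixes t v :: "'a \<Rightarrow> real"
  assumes int: "integrable M t" "integrable M (\<lambda>x. exp (t x))" "integrable M v"
    and nonneg: "\<And>x. 0 \<le> v x"
    and min: "\<And>\<delta>. 0 < \<delta> \<Longrightarrow> integrable M (\<lambda>x. exp (t x - \<delta> * v x)) \<Longrightarrow>
      (\<integral>x. exp (t x) - t x \<partial>M) \<le> (\<integral>x. exp (t x - \<delta> * v x) - (t x - \<delta> * v x) \<partial>M)"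
  shows "(\<integral>\<^sup>+x. ennreal (v x * exp (t x)) \<partial>M) \<le> ennreal (\<integral>x. v x \<partial>M)"
proof -
  have [measurable]: "t \<in> borel_measurable M" "v \<in> borel_measurable M"
    using int by auto
  have int_d: "integrable M (\<lambda>x. exp (t x - \<delta> * v x))" if "0 < \<delta>" for \<delta>
    by (rule Bochner_Integration.integrable_bound[OF int(2)]) (use that nonneg in auto)
  define q where "q n x = (exp (t x) - exp (t x - 1 / real (Suc n) * v x)) / (1 / real (Suc n))" for n x
  have q_nonneg: "0 \<le> q n x" for n x
    unfolding q_def using nonneg[of x] by auto
  have q_int: "integrable M (q n)" for n
    unfolding q_def using int(2) int_d[of "1 / real (Suc n)"]
    by (intro integrable_divide Bochner_Integration.integrable_diff) auto
  have q_le: "(\<integral>x. q n x \<partial>M) \<le> (\<integral>x. v x \<partial>M)" for n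
  proof -
    let ?d = "1 / real (Suc n)"
    have d: "0 < ?d" by simp
    note I = int int_d[OF d]
    have "(\<integral>x. exp (t x) - t x \<partial>M) \<le> (\<integral>x. exp (t x - ?d * v x) - (t x - ?d * v x) \<partial>M)"
      using min[OF d int_d[OF d]] .
    then have "(\<integral>x. exp (t x) \<partial>M) - (\<integral>x. exp (t x - ?d * v x) \<partial>M) \<le> ?d * (\<integral>x. v x \<partial>M)"
      using I by (simp del: times_divide_eq_left)
    then have "((\<integral>x. exp (t x) \<partial>M) - (\<integral>x. exp (t x - ?d * v x) \<partial>M)) / ?d \<le> (\<integral>x. v x \<partial>M)"
      using d by (subst pos_divide_le_eq) (auto simp: mult.commute)
    moreover have "(\<integral>x. q n x \<partial>M) = ((\<integral>x. exp (t x) \<partial>M) - (\<integral>x. exp (t x - ?d * v x) \<partial>M)) / ?d"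
      unfolding q_def using I by (subst integral_divide_zero, subst Bochner_Integration.integral_diff) auto
    ultimately show ?thesis by simp
  qed
  have q_lim: "(\<lambda>n. q n x) \<longlonglongrightarrow> v x * exp (t x)" for x
  proof -
    have "((\<lambda>\<delta>. exp (t x - \<delta> * v x)) has_real_derivative (- v x) * exp (t x)) (at 0)"
      by (auto intro!: derivative_eq_intros)
    then have "((\<lambda>\<delta>. (exp (t x - \<delta> * v x) - exp (t x)) / \<delta>) \<longlongrightarrow> (- v x) * exp (t x)) (at 0)"
      by (simp add: DERIV_def)
    moreover have "filterlim (\<lambda>n. 1 / real (Suc n)) (at 0) sequentially"
      by (rule filterlim_atI) (use LIMSEQ_Suc[OF lim_inverse_n'] in auto)
    ultimately have "(\<lambda>n. (exp (t x - 1 / real (Suc n) * v x) - exp (t x)) / (1 / real (Suc n)))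
        \<longlonglongrightarrow> (- v x) * exp (t x)"
      by (rule filterlim_compose)
    from tendsto_minus[OF this] show ?thesis
      unfolding q_def by (simp only: minus_divide_left minus_diff_eq mult_minus_left minus_minus)
  qed
  have "(\<integral>\<^sup>+x. ennreal (v x * exp (t x)) \<partial>M) = (\<integral>\<^sup>+x. liminf (\<lambda>n. ennreal (q n x)) \<partial>M)"
    using q_lim by (intro nn_integral_cong lim_imp_Liminf[symmetric] tendsto_ennrealI) auto
  also have "\<dots> \<le> liminf (\<lambda>n. \<integral>\<^sup>+x. ennreal (q n x) \<partial>M)"
    using q_int by (intro nn_integral_liminf) auto
  also have "\<dots> \<le> liminf (\<lambda>n. ennreal (\<integral>x. v x \<partial>M))"
    using q_int q_nonneg q_le
    by (intro Liminf_mono always_eventually allI) (auto simp: nn_integral_eq_integral intro!: ennreal_leI)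
  also have "\<dots> = ennreal (\<integral>x. v x \<partial>M)"
    by (intro Liminf_const) auto
  finally show ?thesis .
qed

lemma (in prob_space) minimiser_mass_ge_1:
  fixes t :: "'a \<Rightarrow> real"
  assumes int: "integrable M t" "integrable M (\<lambda>x. exp (t x))"
    and min: "\<And>\<delta>. 0 < \<delta> \<Longrightarrow> integrable M (\<lambda>x. exp (t x + \<delta>)) \<Longrightarrow>
      (\<integral>x. exp (t x) - t x \<partial>M) \<le> (\<integral>x. exp (t x + \<delta>) - (t x + \<delta>) \<partial>M)"
  shows "1 \<le> (\<integral>x. exp (t x) \<partial>M)"
proof -
  let ?A = "\<integral>x. exp (t x) \<partial>M"
  have *: "1 \<le> ?A * ((exp \<delta> - 1) / \<delta>)" if "0 < \<delta>" for \<delta>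
  proof -
    have i: "integrable M (\<lambda>x. exp (t x + \<delta>))"
      using int(2) by (simp add: exp_add)
    have "?A - (\<integral>x. t x \<partial>M) \<le> (\<integral>x. exp (t x + \<delta>) \<partial>M) - ((\<integral>x. t x \<partial>M) + \<delta>)"
      using min[OF that i] int i by (simp add: prob_space)
    also have "(\<integral>x. exp (t x + \<delta>) \<partial>M) = ?A * exp \<delta>"
      by (simp add: exp_add)
    finally show ?thesis
      using that by (simp add: field_simps)
  qed
  have "((\<lambda>\<delta>. (exp \<delta> - 1) / \<delta>) \<longlongrightarrow> 1) (at (0::real))"
    using DERIV_exp[of "0::real"] by (simp add: DERIV_def)
  then have "((\<lambda>\<delta>. ?A * ((exp \<delta> - 1) / \<delta>)) \<longlongrightarrow> ?A * 1) (at_right 0)"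
    by (intro tendsto_intros) (rule tendsto_mono[OF at_le], auto)
  then have "1 \<le> ?A * 1"
    by (rule tendsto_lowerbound) (use * in \<open>auto simp: eventually_at_right_less intro: eventually_mono[OF eventually_at_right_less]\<close>)
  then show ?thesis by simp
qed

section \<open>Measures on product spaces and elementary inequalities\<close>

text \<open>Measurability of the projections for the Borel \<open>\<sigma>\<close>-algebra of a product space rather than
  the product of the two Borel \<open>\<sigma>\<close>-algebras.\<close>

lemma borel_measurable_fst_snd[measurable (raw)]:
  fixes z :: "'a \<Rightarrow> 'b::second_countable_topology \<times> 'c::second_countable_topology"
  assumes "z \<in> borel_measurable M"
  shows "(\<lambda>x. fst (z x)) \<in> borel_measurable M" "(\<lambda>x. snd (z x)) \<in> borel_measurable M"
  by (rule measurable_compose[OF assms borel_measurable_continuous_onI], intro continuous_intros)+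

lemma prob_space_eqI_le:
  assumes "prob_space P" "prob_space Q" and sets: "sets P = sets Q"
    and le: "\<And>A. A \<in> sets P \<Longrightarrow> emeasure P A \<le> emeasure Q A"
  shows "P = Q"
proof (rule measure_eqI[OF sets])
  fix A assume A: "A \<in> sets P"
  interpret P: prob_space P by fact
  interpret Q: prob_space Q by fact
  have le': "measure P B \<le> measure Q B" if "B \<in> sets P" for B
    using le[OF that] by (simp add: P.emeasure_eq_measure Q.emeasure_eq_measure)
  have sp: "space P = space Q" using sets by (rule sets_eq_imp_space_eq)
  have "measure P (space P - A) \<le> measure Q (space P - A)"
    using A by (intro le') auto
  then have "measure Q A \<le> measure P A"
    using P.prob_compl[OF A] Q.prob_compl[of A] A sets sp by simp
  with le'[OF A] show "emeasure P A = emeasure Q A"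
    by (simp add: P.emeasure_eq_measure Q.emeasure_eq_measure)
qed

text \<open>A conditional law disintegrates the measure: the formula on rectangles extends to all
  nonnegative functions.\<close>

lemma nn_integral_conditional_law:
  fixes \<pi> :: "('a::second_countable_topology \<times> 'b::second_countable_topology) measure"
  assumes "prob_space \<pi>" and sets: "sets \<pi> = sets borel"
    and K: "is_conditional_law \<pi> K" and F: "F \<in> borel_measurable borel"
  shows "(\<integral>\<^sup>+w. F w \<partial>\<pi>) = (\<integral>\<^sup>+u. \<integral>\<^sup>+z. F (u, z) \<partial>K u \<partial>distr \<pi> borel fst)"
proof -
  interpret prob_space \<pi> by fact
  define m where "m = distr \<pi> borel fst"
  have K_meas: "K \<in> borel \<rightarrow>\<^sub>M subprob_algebra borel"
    using K measurable_prob_algebraD by (auto simp: is_conditional_law_def)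
  have sets_K: "sets (K u) = sets borel" for u
    using sets_kernel[OF K_meas, of u] by simp
  have sets_m: "sets m = sets borel" by (simp add: m_def)
  have space_m: "space m = UNIV" by (simp add: m_def)
  define L where "L u = distr (K u) (borel :: ('a \<times> 'b) measure) (Pair u)" for u
  have pair: "(\<lambda>(u, z). (u, z)) \<in> (borel :: 'a measure) \<Otimes>\<^sub>M (borel :: 'b measure) \<rightarrow>\<^sub>M borel"
    by (simp add: borel_prod)
  have L: "L \<in> m \<rightarrow>\<^sub>M subprob_algebra borel"
    unfolding L_def measurable_cong_sets[OF sets_m refl]
    using pair K_meas by (rule measurable_distr2)
  have Pair_meas: "Pair u \<in> K u \<rightarrow>\<^sub>M borel" for u
    unfolding measurable_cong_sets[OF sets_K refl]
    by (intro borel_measurable_continuous_onI continuous_intros)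
  have "\<pi> = m \<bind> L"
  proof (rule measure_eqI_generator_eq[where A = "\<lambda>_. UNIV" and \<Omega> = UNIV and
      E = "{A \<times> B | A B. A \<in> sets (borel :: 'a measure) \<and> B \<in> sets (borel :: 'b measure)}"])
    show "Int_stable {A \<times> B | A B. A \<in> sets (borel :: 'a measure) \<and> B \<in> sets (borel :: 'b measure)}"
      by (rule Int_stable_pair_measure_generator)
    have gen: "sets (borel :: ('a \<times> 'b) measure)
      = sigma_sets UNIV {A \<times> B | A B. A \<in> sets (borel :: 'a measure) \<and> B \<in> sets (borel :: 'b measure)}"
      by (subst borel_prod[symmetric]) (simp add: sets_pair_measure)
    show "sets \<pi> = sigma_sets UNIV {A \<times> B | A B. A \<in> sets (borel :: 'a measure) \<and> B \<in> sets (borel :: 'b measure)}"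
      using sets gen by simp
    have "sets (m \<bind> L) = sets borel"
      using L space_m by (intro sets_bind) (auto simp: sets_kernel)
    then show "sets (m \<bind> L) = sigma_sets UNIV {A \<times> B | A B. A \<in> sets (borel :: 'a measure) \<and> B \<in> sets (borel :: 'b measure)}"
      using gen by simp
    fix X assume "X \<in> {A \<times> B | A B. A \<in> sets (borel :: 'a measure) \<and> B \<in> sets (borel :: 'b measure)}"
    then obtain A B where X: "X = A \<times> B" and A: "A \<in> sets borel" and B: "B \<in> sets borel"
      by auto
    have "emeasure (L u) X = indicator A u * emeasure (K u) B" for u
    proof -
      have "Pair u -` X \<inter> space (K u) = (if u \<in> A then B else {})"
        using sets.sets_into_space[of B "K u"] B sets_K by (auto simp: X)
      moreover have "X \<in> sets borel"
        unfolding X using A B by (subst borel_prod[symmetric]) auto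
      ultimately show ?thesis
        unfolding L_def using Pair_meas by (subst emeasure_distr) auto
    qed
    moreover have "X \<in> sets borel"
      unfolding X using A B by (subst borel_prod[symmetric]) auto
    ultimately have "emeasure (m \<bind> L) X = (\<integral>\<^sup>+u. indicator A u * emeasure (K u) B \<partial>m)"
      using L space_m by (subst emeasure_bind) auto
    also have "\<dots> = emeasure \<pi> X"
      using K A B by (simp add: is_conditional_law_def X m_def mult.commute)
    finally show "emeasure \<pi> X = emeasure (m \<bind> L) X" ..
  qed (auto intro!: exI[of _ UNIV])
  then have "(\<integral>\<^sup>+w. F w \<partial>\<pi>) = (\<integral>\<^sup>+u. \<integral>\<^sup>+w. F w \<partial>L u \<partial>m)"
    using F L by (simp add: nn_integral_bind)
  also have "\<dots> = (\<integral>\<^sup>+u. \<integral>\<^sup>+z. F (u, z) \<partial>K u \<partial>m)"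
    unfolding L_def using Pair_meas F by (intro nn_integral_cong) (simp add: nn_integral_distr)
  finally show ?thesis by (simp add: m_def)
qed

lemma exp_eq_add_one_self_iff: "exp y = 1 + y \<longleftrightarrow> y = 0" for y :: real
proof
  assume eq: "exp y = 1 + y"
  then have "- 1 < y" using exp_gt_zero[of y] by linarith
  then have "(1 + y / 2)\<^sup>2 \<le> (exp (y / 2))\<^sup>2"
    using exp_ge_add_one_self[of "y / 2"] by (intro power_mono) auto
  also have "\<dots> = 1 + y" using eq by (simp add: exp_double[symmetric])
  finally have "y\<^sup>2 \<le> 0" by (simp add: power2_eq_square algebra_simps)
  then show "y = 0" by simp
qed simp

lemma minus_mult_exp_le_1: "- t * exp t \<le> 1" for t :: real
proof -
  have "- t \<le> exp (- t)" using exp_ge_add_one_self[of "- t"] by linarith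
  then have "- t * exp t \<le> exp (- t) * exp t" by (intro mult_right_mono) auto
  then show ?thesis by (simp add: exp_minus)
qed

section \<open>The problem and sums of potentials\<close>

text \<open>Only a first moment of the martingale component \<open>x\<close> is required. The assumption
  \<open>nondegenerate\<close> says that the constant 1 and the coordinates of \<open>x\<close> are linearly independent modulo
  \<open>\<nu>\<close>-null sets.\<close>

locale martingale_coupling_problem =
  fixes \<mu> :: "'u::euclidean_space measure"
    and \<nu> :: "('x::euclidean_space \<times> 'u) measure"
    and \<epsilon> :: real
  assumes prob_\<mu>: "prob_space \<mu>" and sets_\<mu>[measurable_cong, simp]: "sets \<mu> = sets borel"
    and prob_\<nu>: "prob_space \<nu>" and sets_\<nu>[measurable_cong, simp]: "sets \<nu> = sets borel"
    and second_moment_\<mu>: "integrable \<mu> (\<lambda>u. (norm u)\<^sup>2)"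
    and second_moment_\<nu>: "integrable \<nu> (\<lambda>z. (norm (snd z))\<^sup>2)"
    and integrable_fst_\<nu>: "integrable \<nu> fst"
    and mean_zero: "(\<integral>z. fst z \<partial>\<nu>) = 0"
    and nondegenerate: "\<And>a b. AE z in \<nu>. a + b \<bullet> fst z = 0 \<Longrightarrow> a = 0 \<and> b = 0"
    and \<epsilon>_pos: "0 < \<epsilon>"
begin

sublocale \<mu>: prob_space \<mu> by (rule prob_\<mu>)
sublocale \<nu>: prob_space \<nu> by (rule prob_\<nu>)
sublocale R: pair_prob_space \<mu> \<nu> ..

abbreviation R :: "('u \<times> 'x \<times> 'u) measure" where "R \<equiv> \<mu> \<Otimes>\<^sub>M \<nu>"

lemma space_\<mu>[simp]: "space \<mu> = UNIV"
  using sets_eq_imp_space_eq[OF sets_\<mu>] by simp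

lemma space_\<nu>[simp]: "space \<nu> = UNIV"
  using sets_eq_imp_space_eq[OF sets_\<nu>] by simp

lemma space_R[simp]: "space R = UNIV"
  by (simp add: space_pair_measure)

lemma sets_R: "sets R = sets borel"
proof -
  have "sets R = sets (borel \<Otimes>\<^sub>M (borel :: ('x \<times> 'u) measure))"
    by (intro sets_pair_measure_cong) simp_all
  then show ?thesis by (simp only: borel_prod)
qed

text \<open>Linear properties that hold for almost every vector \<open>(1, x)\<close> hold for all vectors. This is
  the way in which nondegeneracy enters.\<close>

lemma subspace_eq_UNIV:
  fixes W :: "(real \<times> 'x) set"
  assumes "subspace W" and "AE z in \<nu>. (1, fst z) \<in> W"
  shows "W = UNIV"
proof (rule ccontr)
  assume "W \<noteq> UNIV"
  then have "span W \<noteq> UNIV" using assms(1) by (metis span_eq_iff)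
  then have "dim W < DIM(real \<times> 'x)"
    using dim_eq_full[of W] dim_subset_UNIV[of W] by simp
  then obtain n where n: "n \<noteq> 0" "\<And>w. w \<in> W \<Longrightarrow> orthogonal n w"
    using orthogonal_to_subspace_exists[of W] span_base by metis
  have "AE z in \<nu>. fst n + snd n \<bullet> fst z = 0"
    using assms(2)
  proof eventually_elim
    case (elim z)
    then have "orthogonal n (1, fst z)" by (rule n)
    then show ?case by (simp add: orthogonal_def inner_prod_def)
  qed
  from nondegenerate[OF this] n(1) show False by (simp add: prod_eq_iff)
qed

lemma convergent_coefficients:
  fixes a :: "nat \<Rightarrow> real" and b :: "nat \<Rightarrow> 'x"
  assumes "AE z in \<nu>. convergent (\<lambda>n. a n + b n \<bullet> fst z)"
  shows "convergent a" "convergent b"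
proof -
  define W where "W = {(p, q). convergent (\<lambda>n. a n * p + b n \<bullet> q)}"
  have "subspace W"
    unfolding subspace_def
  proof (intro conjI ballI allI)
    show "0 \<in> W" by (simp add: W_def zero_prod_def convergent_const)
  next
    fix v w assume "v \<in> W" "w \<in> W"
    then show "v + w \<in> W"
      by (auto simp: W_def inner_add_right distrib_left dest: convergent_add)
        (drule (1) convergent_add, simp add: algebra_simps)
  next
    fix c :: real and v assume "v \<in> W"
    then have "convergent (\<lambda>n. c * (a n * fst v + b n \<bullet> snd v))"
      by (intro convergent_mult convergent_const) (auto simp: W_def)
    then show "c *\<^sub>R v \<in> W"
      by (cases v) (simp add: W_def algebra_simps)
  qed
  moreover have "AE z in \<nu>. (1, fst z) \<in> W"
    using assms by (simp add: W_def)
  ultimately have "W = UNIV" by (rule subspace_eq_UNIV)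
  then have *: "convergent (\<lambda>n. a n * p + b n \<bullet> q)" for p q
    by (auto simp: W_def)
  show "convergent a" using *[of 1 0] by simp
  have "\<forall>i\<in>Basis. convergent (\<lambda>n. b n \<bullet> i)"
    using *[of 0] by simp
  then obtain l where "\<forall>i\<in>Basis. (\<lambda>n. b n \<bullet> i) \<longlonglongrightarrow> l i"
    unfolding convergent_def by metis
  then have "b \<longlonglongrightarrow> (\<Sum>i\<in>Basis. l i *\<^sub>R i)"
    by (subst tendsto_componentwise_iff) (auto simp: inner_sum_left_Basis)
  then show "convergent b" by (auto simp: convergent_def)
qed

lemma integrable_coefficients:
  assumes [measurable]: "f \<in> borel_measurable borel" "g \<in> borel_measurable borel"
    and ae: "AE z in \<nu>. integrable \<mu> (\<lambda>u. f u + g u \<bullet> fst z)"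
  shows "integrable \<mu> f" "integrable \<mu> g"
proof -
  define W where "W = {(p, q). integrable \<mu> (\<lambda>u. f u * p + g u \<bullet> q)}"
  have "subspace W"
    unfolding subspace_def
  proof (intro conjI ballI allI)
    show "0 \<in> W" by (simp add: W_def zero_prod_def)
  next
    fix v w assume "v \<in> W" "w \<in> W"
    then show "v + w \<in> W"
      by (auto simp: W_def inner_add_right distrib_left)
        (drule (1) Bochner_Integration.integrable_add, simp add: algebra_simps)
  next
    fix c :: real and v assume "v \<in> W"
    then have "integrable \<mu> (\<lambda>u. c * (f u * fst v + g u \<bullet> snd v))"
      by (intro integrable_mult_right) (auto simp: W_def)
    then show "c *\<^sub>R v \<in> W"
      by (cases v) (simp add: W_def algebra_simps)
  qed
  moreover have "AE z in \<nu>. (1, fst z) \<in> W"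
    using ae by (simp add: W_def)
  ultimately have "W = UNIV" by (rule subspace_eq_UNIV)
  then have *: "integrable \<mu> (\<lambda>u. f u * p + g u \<bullet> q)" for p q
    by (auto simp: W_def)
  show "integrable \<mu> f" using *[of 1 0] by simp
  have "integrable \<mu> (\<lambda>u. \<Sum>i\<in>Basis. (g u \<bullet> i) *\<^sub>R i)"
    using *[of 0] by (intro Bochner_Integration.integrable_sum integrable_scaleR_left) simp
  then show "integrable \<mu> g" by (simp add: euclidean_representation)
qed

lemma measurable_snd_R[measurable (raw)]:
  "h \<in> borel_measurable borel \<Longrightarrow> (\<lambda>w. h (snd w)) \<in> borel_measurable R"
  by (rule measurable_compose[OF measurable_snd]) simp

text \<open>The dual variables combined into one function on the product space.\<close>

definition potentials :: "('u \<Rightarrow> real) \<Rightarrow> ('u \<Rightarrow> 'x) \<Rightarrow> ('x \<times> 'u \<Rightarrow> real) \<Rightarrow> 'u \<times> 'x \<times> 'u \<Rightarrow> real"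
  where "potentials f g h = (\<lambda>(u, z). f u + g u \<bullet> fst z + h z)"

lemma measurable_potentials[measurable]:
  assumes [measurable]: "f \<in> borel_measurable borel" "g \<in> borel_measurable borel"
    "h \<in> borel_measurable borel"
  shows "potentials f g h \<in> borel_measurable R"
  unfolding potentials_def case_prod_beta by measurable

lemma integrable_fst_R: "integrable R (\<lambda>w. f (fst w))" 
    "(\<integral>w. f (fst w) \<partial>R) = (\<integral>u. f u \<partial>\<mu>)"
  if "integrable \<mu> f" for f :: "'u \<Rightarrow> real"
proof -
  have eq: "distr R \<mu> fst = \<mu>" by (rule \<nu>.distr_pair_fst)
  show "integrable R (\<lambda>w. f (fst w))"
    by (rule integrable_distr[where M' = \<mu>]) (use that in \<open>simp_all add: eq\<close>)
  show "(\<integral>w. f (fst w) \<partial>R) = (\<integral>u. f u \<partial>\<mu>)"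
    using that by (subst (2) eq[symmetric], subst integral_distr) auto
qed

lemma distr_R_snd: "distr R \<nu> snd = \<nu>"
proof (rule measure_eqI)
  fix A assume "A \<in> sets (distr R \<nu> snd)"
  then have A: "A \<in> sets \<nu>" by simp
  have "snd -` A \<inter> space R = space \<mu> \<times> A" by auto
  with A show "emeasure (distr R \<nu> snd) A = emeasure \<nu> A"
    by (simp add: emeasure_distr \<nu>.emeasure_pair_measure_Times \<mu>.emeasure_space_1[simplified])
qed simp

lemma integrable_snd_R: "integrable R (\<lambda>w. f (snd w))" 
    "(\<integral>w. f (snd w) \<partial>R) = (\<integral>z. f z \<partial>\<nu>)"
  if "integrable \<nu> f" for f :: "'x \<times> 'u \<Rightarrow> real"
proof -
  show "integrable R (\<lambda>w. f (snd w))"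
    by (rule integrable_distr[where M' = \<nu>]) (use that in \<open>simp_all add: distr_R_snd\<close>)
  show "(\<integral>w. f (snd w) \<partial>R) = (\<integral>z. f z \<partial>\<nu>)"
    using that by (subst (2) distr_R_snd[symmetric], subst integral_distr) auto
qed

lemma integrable_inner_R: "integrable R (\<lambda>w. g (fst w) \<bullet> fst (snd w))"
    "(\<integral>w. g (fst w) \<bullet> fst (snd w) \<partial>R) = 0"
  if g: "integrable \<mu> g" for g :: "'u \<Rightarrow> 'x"
proof -
  have [measurable]: "g \<in> borel_measurable borel"
    using borel_measurable_integrable[OF g] by simp
  have *: "integrable \<nu> (\<lambda>z. b \<bullet> fst z)" "(\<integral>z. b \<bullet> fst z \<partial>\<nu>) = 0" for b
    using integrable_fst_\<nu> mean_zero by auto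
  show int: "integrable R (\<lambda>w. g (fst w) \<bullet> fst (snd w))"
  proof (rule R.Fubini_integrable)
    show "(\<lambda>w. g (fst w) \<bullet> fst (snd w)) \<in> borel_measurable R" by measurable
    show "AE u in \<mu>. integrable \<nu> (\<lambda>z. g (fst (u, z)) \<bullet> fst (snd (u, z)))"
      using * by simp
    have "integrable \<mu> (\<lambda>u. norm (g u) * (\<integral>z. norm (fst z) \<partial>\<nu>))"
      using g by auto
    then show "integrable \<mu> (\<lambda>u. \<integral>z. norm (g (fst (u, z)) \<bullet> fst (snd (u, z))) \<partial>\<nu>)"
    proof (rule Bochner_Integration.integrable_bound)
      have "(\<integral>z. \<bar>g u \<bullet> fst z\<bar> \<partial>\<nu>) \<le> (\<integral>z. norm (g u) * norm (fst z) \<partial>\<nu>)" for u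
        using * integrable_fst_\<nu> by (intro integral_mono) (auto simp: Cauchy_Schwarz_ineq2)
      then show "AE u in \<mu>. norm (\<integral>z. norm (g (fst (u, z)) \<bullet> fst (snd (u, z))) \<partial>\<nu>)
          \<le> norm (norm (g u) * (\<integral>z. norm (fst z) \<partial>\<nu>))"
        by (intro AE_I2) simp
    qed measurable
  qed
  show "(\<integral>w. g (fst w) \<bullet> fst (snd w) \<partial>R) = 0"
    using R.integral_fst'[OF int] * by simp
qed

lemma potentials_integrable:
  assumes "integrable \<mu> f" "integrable \<mu> g" "integrable \<nu> h"
  shows "integrable R (potentials f g h)"
    and "(\<integral>w. potentials f g h w \<partial>R) = (\<integral>u. f u \<partial>\<mu>) + (\<integral>z. h z \<partial>\<nu>)"
  unfolding potentials_def case_prod_beta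
  using integrable_fst_R[OF assms(1)] integrable_inner_R[OF assms(2)] integrable_snd_R[OF assms(3)]
  by simp_all

text \<open>An almost everywhere limit of sums of potentials is again such a sum, and integrability of the
  limit passes to the three summands separately. Both rest on the reference measure being a
  product.\<close>

lemma potentials_closed:
  assumes meas: "\<And>n. f n \<in> borel_measurable borel" "\<And>n. g n \<in> borel_measurable borel"
      "\<And>n. h n \<in> borel_measurable borel"
    and lim: "AE w in R. (\<lambda>n. potentials (f n) (g n) (h n) w) \<longlonglongrightarrow> t w"
    and t: "integrable R t"
  obtains f' g' h' where "integrable \<mu> f'" "integrable \<mu> g'" "integrable \<nu> h'"
    "AE w in R. t w = potentials f' g' h' w"
proof -
  note meas[measurable]
  have ae_u: "AE u in \<mu>. AE z in \<nu>. (\<lambda>n. potentials (f n) (g n) (h n) (u, z)) \<longlonglongrightarrow> t (u, z)"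
    using lim by (rule R.AE_pair)
  obtain u0 where u0: "AE z in \<nu>. (\<lambda>n. potentials (f n) (g n) (h n) (u0, z)) \<longlonglongrightarrow> t (u0, z)"
    using eventually_happens[OF ae_u] \<mu>.ae_filter_bot by (auto simp: trivial_limit_def)
  \<comment> \<open>Potentials are unique only up to moving \<open>a + b \<bullet> x\<close> between the first two and the third;
    normalising \<open>f n\<close> and \<open>g n\<close> to vanish at \<open>u0\<close> makes the three sequences converge.\<close>
  define h' where "h' z = lim (\<lambda>n. potentials (f n) (g n) (h n) (u0, z))" for z
  define f' where "f' u = lim (\<lambda>n. f n u - f n u0)" for u
  define g' where "g' u = lim (\<lambda>n. g n u - g n u0)" for u
  have h'_meas[measurable]: "h' \<in> borel_measurable borel"
    unfolding h'_def potentials_def prod.case by measurable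
  have f'_meas[measurable]: "f' \<in> borel_measurable borel"
    unfolding f'_def by measurable
  have g'_meas[measurable]: "g' \<in> borel_measurable borel"
    unfolding g'_def by measurable
  have t_meas[measurable]: "t \<in> borel_measurable R"
    using t by auto
  have eq_u: "AE u in \<mu>. AE z in \<nu>. t (u, z) = potentials f' g' h' (u, z)"
    using ae_u
  proof eventually_elim
    case (elim u)
    have ae_z: "AE z in \<nu>. (\<lambda>n. (f n u - f n u0) + (g n u - g n u0) \<bullet> fst z) \<longlonglongrightarrow> t (u, z) - t (u0, z)"
      using elim u0
    proof eventually_elim
      case (elim z)
      from tendsto_diff[OF this] show ?case
        by (simp add: potentials_def algebra_simps)
    qed
    then have "AE z in \<nu>. convergent (\<lambda>n. (f n u - f n u0) + (g n u - g n u0) \<bullet> fst z)"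
      by eventually_elim (auto simp: convergent_def)
    note conv = convergent_coefficients[OF this]
    have fl: "(\<lambda>n. f n u - f n u0) \<longlonglongrightarrow> f' u" and gl: "(\<lambda>n. g n u - g n u0) \<longlonglongrightarrow> g' u"
      using conv unfolding f'_def g'_def by (auto simp: convergent_LIMSEQ_iff)
    show ?case
      using ae_z u0
    proof eventually_elim
      case (elim z)
      have "(\<lambda>n. (f n u - f n u0) + (g n u - g n u0) \<bullet> fst z) \<longlonglongrightarrow> f' u + g' u \<bullet> fst z"
        by (intro tendsto_intros fl gl)
      then have "t (u, z) - t (u0, z) = f' u + g' u \<bullet> fst z"
        using elim(1) LIMSEQ_unique by blast
      moreover have "h' z = t (u0, z)"
        unfolding h'_def using elim(2) by (rule limI)
      ultimately show ?case by (simp add: potentials_def)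
    qed
  qed
  have eq: "AE w in R. t w = potentials f' g' h' w"
  proof (rule R.AE_pair_measure)
    show "{w \<in> space R. t w = potentials f' g' h' w} \<in> sets R" by measurable
  qed (rule eq_u)
  have "integrable R (potentials f' g' h')"
    using t eq by (subst integrable_cong_AE[of _ _ t]) auto
  note int = this
  from R.integrable_product_swap[OF int]
  have int_swap: "integrable (\<nu> \<Otimes>\<^sub>M \<mu>) (\<lambda>(z, u). potentials f' g' h' (u, z))" .
  interpret R': pair_prob_space \<nu> \<mu> ..
  from R'.AE_integrable_fst'[OF int_swap]
  have "AE z in \<nu>. integrable \<mu> (\<lambda>u. f' u + g' u \<bullet> fst z)"
  proof eventually_elim
    case (elim z)
    then have "integrable \<mu> (\<lambda>u. potentials f' g' h' (u, z) - h' z)"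
      by simp
    then show ?case by (simp add: potentials_def)
  qed
  from integrable_coefficients[OF f'_meas g'_meas this]
  have fg: "integrable \<mu> f'" "integrable \<mu> g'" .
  have "integrable R (\<lambda>w. potentials f' g' h' w - potentials f' g' (\<lambda>_. 0) w)"
    by (intro Bochner_Integration.integrable_diff[OF int] potentials_integrable(1)[OF fg]) simp
  then have "integrable R (\<lambda>w. h' (snd w))"
    by (simp add: potentials_def case_prod_beta)
  then have "integrable (distr R \<nu> snd) h'"
    by (subst integrable_distr_eq) auto
  then have "integrable \<nu> h'"
    by (simp add: distr_R_snd)
  with fg eq show ?thesis by (intro that)
qed

section \<open>Existence of a minimiser\<close>

text \<open>The logarithm of the Gibbs density.\<close>

definition exponent :: "('u \<Rightarrow> real) \<Rightarrow> ('u \<Rightarrow> 'x) \<Rightarrow> ('x \<times> 'u \<Rightarrow> real) \<Rightarrow> 'u \<times> 'x \<times> 'u \<Rightarrow> real"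
  where "exponent f g h w = (potentials f g h w - cost (fst w) (snd (snd w))) / \<epsilon>"

lemma gibbs_density_eq: "gibbs_density \<epsilon> f g h w = exp (exponent f g h w)"
  by (simp add: gibbs_density_def exponent_def potentials_def case_prod_beta)

lemma measurable_cost[measurable]: "(\<lambda>w. cost (fst w) (snd (snd w))) \<in> borel_measurable R"
  unfolding cost_def by measurable

lemma cost_nonneg: "0 \<le> cost u y"
  by (simp add: cost_def)

lemma cost_le: "cost u y \<le> (norm u)\<^sup>2 + (norm y)\<^sup>2"
proof -
  have "(norm (u - y))\<^sup>2 \<le> (norm u + norm y)\<^sup>2"
    by (intro power_mono norm_triangle_ineq4) auto
  moreover have "0 \<le> (norm u - norm y)\<^sup>2" by simp
  ultimately show ?thesis
    by (simp add: cost_def power2_eq_square algebra_simps)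
qed

lemma integrable_borel:
  "integrable \<mu> a \<Longrightarrow> a \<in> borel_measurable borel" "integrable \<nu> b \<Longrightarrow> b \<in> borel_measurable borel"
  for a :: "'u \<Rightarrow> 'b::{banach, second_countable_topology}"
    and b :: "'x \<times> 'u \<Rightarrow> 'c::{banach, second_countable_topology}"
  using borel_measurable_integrable[of \<mu> a] borel_measurable_integrable[of \<nu> b] by simp_all

lemma integrable_cost_R: "integrable R (\<lambda>w. cost (fst w) (snd (snd w)))"
proof (rule Bochner_Integration.integrable_bound)
  show "integrable R (\<lambda>w. (norm (fst w))\<^sup>2 + (norm (snd (snd w)))\<^sup>2)"
    using integrable_fst_R(1)[OF second_moment_\<mu>] integrable_snd_R(1)[OF second_moment_\<nu>] by simp
  show "AE w in R. norm (cost (fst w) (snd (snd w))) \<le> norm ((norm (fst w))\<^sup>2 + (norm (snd (snd w)))\<^sup>2)"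
    by (intro AE_I2) (simp add: cost_le cost_nonneg)
qed measurable

lemma exponent_integrable:
  assumes "integrable \<mu> f" "integrable \<mu> g" "integrable \<nu> h"
  shows "integrable R (exponent f g h)"
  unfolding exponent_def[abs_def]
  using potentials_integrable(1)[OF assms] integrable_cost_R by simp

lemma exponent_add_potentials:
  "exponent (\<lambda>u. f u + c * a u) (\<lambda>u. g u + c *\<^sub>R b u) (\<lambda>z. h z + c * k z) w
    = exponent f g h w + c / \<epsilon> * potentials a b k w"
  using \<epsilon>_pos by (simp add: exponent_def potentials_def case_prod_beta field_simps inner_add_left)

text \<open>The functional \<open>\<integral> exp t - t \<partial>R\<close> of the exponent \<open>t\<close> is, up to a positive factor and an
  additive constant, the negative of the dual objective. Unlike the latter it has a nonnegative
  integrand.\<close>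

definition is_minimiser :: "('u \<Rightarrow> real) \<Rightarrow> ('u \<Rightarrow> 'x) \<Rightarrow> ('x \<times> 'u \<Rightarrow> real) \<Rightarrow> bool"
  where "is_minimiser f g h \<longleftrightarrow>
    integrable \<mu> f \<and> integrable \<mu> g \<and> integrable \<nu> h \<and>
    integrable R (\<lambda>w. exp (exponent f g h w)) \<and>
    (\<forall>f' g' h'. integrable \<mu> f' \<longrightarrow> integrable \<mu> g' \<longrightarrow> integrable \<nu> h' \<longrightarrow>
      integrable R (\<lambda>w. exp (exponent f' g' h' w)) \<longrightarrow>
      (\<integral>w. exp (exponent f g h w) - exponent f g h w \<partial>R)
        \<le> (\<integral>w. exp (exponent f' g' h' w) - exponent f' g' h' w \<partial>R))"

lemma is_minimiserD:
  assumes "is_minimiser f g h"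
  shows "integrable \<mu> f" "integrable \<mu> g" "integrable \<nu> h"
    "integrable R (\<lambda>w. exp (exponent f g h w))"
    "\<And>f' g' h'. integrable \<mu> f' \<Longrightarrow> integrable \<mu> g' \<Longrightarrow> integrable \<nu> h' \<Longrightarrow>
      integrable R (\<lambda>w. exp (exponent f' g' h' w)) \<Longrightarrow>
      (\<integral>w. exp (exponent f g h w) - exponent f g h w \<partial>R)
        \<le> (\<integral>w. exp (exponent f' g' h' w) - exponent f' g' h' w \<partial>R)"
  using assms by (simp_all add: is_minimiser_def)

lemma exists_minimiser:
  obtains f g h where "is_minimiser f g h"
proof -
  define T where "T = {exponent f g h | f g h. integrable \<mu> f \<and> integrable \<mu> g \<and> integrable \<nu> h}"
  have TI: "exponent f g h \<in> T" if "integrable \<mu> f" "integrable \<mu> g" "integrable \<nu> h" for f g h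
    using that by (auto simp: T_def)
  obtain t where t: "t \<in> T" "integrable R (\<lambda>w. exp (t w))"
    "\<And>s. s \<in> T \<Longrightarrow> integrable R (\<lambda>w. exp (s w)) \<Longrightarrow>
      (\<integral>w. exp (t w) - t w \<partial>R) \<le> (\<integral>w. exp (s w) - s w \<partial>R)"
  proof (rule R.exists_minimiser_exp_minus_self[where T = T])
    show "exponent (\<lambda>_. 0) (\<lambda>_. 0) (\<lambda>_. 0) \<in> T"
      by (auto simp: T_def)
    have "integrable R (exponent (\<lambda>_. 0) (\<lambda>_. 0) (\<lambda>_. 0))"
      by (intro exponent_integrable) auto
    then have [measurable]: "exponent (\<lambda>_. 0) (\<lambda>_. 0) (\<lambda>_. 0) \<in> borel_measurable R" by auto
    show "integrable R (\<lambda>w. exp (exponent (\<lambda>_. 0) (\<lambda>_. 0) (\<lambda>_. 0) w))"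
      by (rule R.integrable_const_bound[of _ 1])
         (use \<epsilon>_pos in \<open>auto simp: exponent_def potentials_def intro!: AE_I2 divide_nonneg_pos cost_nonneg\<close>)
    show "integrable R t" if "t \<in> T" for t
      using that by (auto simp: T_def intro: exponent_integrable)
    show "(\<lambda>w. (a w + b w) / 2) \<in> T" if "a \<in> T" "b \<in> T" for a b
    proof -
      obtain f g h f' g' h' where *: "a = exponent f g h" "b = exponent f' g' h'"
        "integrable \<mu> f" "integrable \<mu> g" "integrable \<nu> h"
        "integrable \<mu> f'" "integrable \<mu> g'" "integrable \<nu> h'"
        using \<open>a \<in> T\<close> \<open>b \<in> T\<close> by (auto simp: T_def)
      have "(\<lambda>w. (a w + b w) / 2) = exponent (\<lambda>u. (f u + f' u) / 2)
          (\<lambda>u. (1/2) *\<^sub>R (g u + g' u)) (\<lambda>z. (h z + h' z) / 2)"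
        using \<epsilon>_pos by (simp add: fun_eq_iff * exponent_def potentials_def case_prod_beta
            field_simps inner_add_left)
      moreover have "exponent (\<lambda>u. (f u + f' u) / 2) (\<lambda>u. (1/2) *\<^sub>R (g u + g' u))
          (\<lambda>z. (h z + h' z) / 2) \<in> T"
        using *(3-) by (intro TI) auto
      ultimately show ?thesis by (simp only:)
    qed
    show "\<exists>t'\<in>T. AE w in R. t w = t' w"
      if s: "\<And>n. s n \<in> T" and lim: "AE w in R. (\<lambda>n. s n w) \<longlonglongrightarrow> t w" and t: "integrable R t" for s t
    proof -
      have "\<forall>n. \<exists>f g h. s n = exponent f g h \<and> integrable \<mu> f \<and> integrable \<mu> g \<and> integrable \<nu> h"
        using s by (auto simp: T_def)
      then obtain f g h where fgh: "\<And>n. s n = exponent (f n) (g n) (h n)"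
        "\<And>n. integrable \<mu> (f n)" "\<And>n. integrable \<mu> (g n)" "\<And>n. integrable \<nu> (h n)"
        by metis
      have lim': "AE w in R. (\<lambda>n. potentials (f n) (g n) (h n) w) \<longlonglongrightarrow> \<epsilon> * t w + cost (fst w) (snd (snd w))"
        using lim
      proof eventually_elim
        case (elim w)
        then have "(\<lambda>n. \<epsilon> * s n w + cost (fst w) (snd (snd w))) \<longlonglongrightarrow> \<epsilon> * t w + cost (fst w) (snd (snd w))"
          by (intro tendsto_intros)
        then show ?case using \<epsilon>_pos by (simp add: fgh exponent_def)
      qed
      have int_t: "integrable R (\<lambda>w. \<epsilon> * t w + cost (fst w) (snd (snd w)))"
        using t integrable_cost_R by simp
      obtain f' g' h' where *: "integrable \<mu> f'" "integrable \<mu> g'" "integrable \<nu> h'"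
        "AE w in R. \<epsilon> * t w + cost (fst w) (snd (snd w)) = potentials f' g' h' w"
        by (rule potentials_closed[OF integrable_borel(1)[OF fgh(2)] integrable_borel(1)[OF fgh(3)]
          integrable_borel(2)[OF fgh(4)] lim' int_t])
      from *(4) have "AE w in R. t w = exponent f' g' h' w"
        by eventually_elim (use \<epsilon>_pos in \<open>simp add: exponent_def field_simps\<close>)
      with * show ?thesis by (auto simp: T_def)
    qed
  qed blast
  from t(1) obtain f g h where eq: "t = exponent f g h"
    and fgh: "integrable \<mu> f" "integrable \<mu> g" "integrable \<nu> h"
    by (auto simp: T_def)
  show ?thesis
    by (rule that[of f g h]) (use fgh t(2,3) TI in \<open>simp add: is_minimiser_def eq\<close>)
qed

section \<open>Integration under couplings\<close>

lemma coupling_marginals: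
  fixes a :: "'u \<Rightarrow> real" and k :: "'x \<times> 'u \<Rightarrow> real"
  assumes "\<pi> \<in> couplings \<mu> \<nu>"
  shows "prob_space \<pi>" "sets \<pi> = sets borel" "sets \<pi> = sets R" "space \<pi> = UNIV"
    and "integrable \<mu> a \<Longrightarrow> integrable \<pi> (\<lambda>w. a (fst w))"
    and "integrable \<mu> a \<Longrightarrow> (\<integral>w. a (fst w) \<partial>\<pi>) = (\<integral>u. a u \<partial>\<mu>)"
    and "integrable \<nu> k \<Longrightarrow> integrable \<pi> (\<lambda>w. k (snd w))"
    and "integrable \<nu> k \<Longrightarrow> (\<integral>w. k (snd w) \<partial>\<pi>) = (\<integral>z. k z \<partial>\<nu>)"
    and "integrable \<pi> (\<lambda>w. cost (fst w) (snd (snd w)))"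
proof -
  have *: "prob_space \<pi>" "sets \<pi> = sets borel" "distr \<pi> borel fst = \<mu>" "distr \<pi> borel snd = \<nu>"
    using assms by (auto simp: couplings_def)
  show "prob_space \<pi>" "sets \<pi> = sets borel" by fact+
  show sets: "sets \<pi> = sets R" using * sets_R by simp
  show "space \<pi> = UNIV" using sets_eq_imp_space_eq[OF sets] by simp
  have [measurable]: "fst \<in> \<pi> \<rightarrow>\<^sub>M borel" "snd \<in> \<pi> \<rightarrow>\<^sub>M borel"
    unfolding measurable_cong_sets[OF *(2) refl]
    by (auto intro!: borel_measurable_continuous_onI continuous_intros)
  show fst_int: "integrable \<pi> (\<lambda>w. a (fst w))" if "integrable \<mu> a" for a :: "'u \<Rightarrow> real"
    by (rule integrable_distr[where M' = borel]) (use that *(3) in auto)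
  show "(\<integral>w. a (fst w) \<partial>\<pi>) = (\<integral>u. a u \<partial>\<mu>)" if "integrable \<mu> a"
    using that integrable_borel(1)[OF that] by (subst *(3)[symmetric], subst integral_distr) auto
  show snd_int: "integrable \<pi> (\<lambda>w. k (snd w))" if "integrable \<nu> k" for k :: "'x \<times> 'u \<Rightarrow> real"
    by (rule integrable_distr[where M' = borel]) (use that *(4) in auto)
  show "(\<integral>w. k (snd w) \<partial>\<pi>) = (\<integral>z. k z \<partial>\<nu>)" if "integrable \<nu> k"
    using that integrable_borel(2)[OF that] by (subst *(4)[symmetric], subst integral_distr) auto
  show "integrable \<pi> (\<lambda>w. cost (fst w) (snd (snd w)))"
  proof (rule Bochner_Integration.integrable_bound)
    show "integrable \<pi> (\<lambda>w. (norm (fst w))\<^sup>2 + (norm (snd (snd w)))\<^sup>2)"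
      using fst_int[OF second_moment_\<mu>] snd_int[OF second_moment_\<nu>] by simp
    show "(\<lambda>w. cost (fst w) (snd (snd w))) \<in> borel_measurable \<pi>"
      unfolding measurable_cong_sets[OF sets refl] by measurable
    show "AE w in \<pi>. norm (cost (fst w) (snd (snd w))) \<le> norm ((norm (fst w))\<^sup>2 + (norm (snd (snd w)))\<^sup>2)"
      by (intro AE_I2) (simp add: cost_le cost_nonneg)
  qed
qed

text \<open>The conditional mean of \<open>x\<close> given \<open>u\<close> vanishes, so that the positive and the negative part of
  \<open>g u \<bullet> x\<close> have equal conditional integrals. Hence a bound from one side suffices for
  integrability, although \<open>g\<close> and \<open>x\<close> are only known to be integrable separately.\<close>

lemma martingale_integral:
  assumes \<pi>: "\<pi> \<in> feasible \<mu> \<nu>" and g: "g \<in> borel_measurable borel"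
    and B: "integrable \<pi> B" "AE w in \<pi>. g (fst w) \<bullet> fst (snd w) \<le> B w"
  shows "integrable \<pi> (\<lambda>w. g (fst w) \<bullet> fst (snd w))" "(\<integral>w. g (fst w) \<bullet> fst (snd w) \<partial>\<pi>) = 0"
proof -
  obtain K where K: "is_conditional_law \<pi> K"
      "AE u in \<mu>. integrable (K u) fst \<and> (\<integral>z. fst z \<partial>K u) = 0"
  proof -
    have "(\<lambda>(x, y). x) = (fst :: 'x \<times> 'u \<Rightarrow> 'x)" by auto
    then show ?thesis
      using \<pi> by (auto simp: feasible_def intro: that)
  qed
  have coup: "\<pi> \<in> couplings \<mu> \<nu>" using \<pi> by (simp add: feasible_def)
  note m = coupling_marginals(1-3)[OF coup]
  have marg: "distr \<pi> borel fst = \<mu>" using coup by (simp add: couplings_def)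
  note g[measurable]
  define G where "G w = g (fst w) \<bullet> fst (snd w)" for w :: "'u \<times> 'x \<times> 'u"
  have G_meas: "G \<in> borel_measurable borel"
    unfolding G_def by measurable
  have G_meas\<pi>[measurable]: "G \<in> borel_measurable \<pi>"
    using G_meas measurable_cong_sets[OF m(2) refl] by blast
  have "(\<integral>\<^sup>+w. ennreal (- G w) \<partial>\<pi>) = (\<integral>\<^sup>+u. \<integral>\<^sup>+z. ennreal (- G (u, z)) \<partial>K u \<partial>\<mu>)"
    using G_meas by (subst nn_integral_conditional_law[OF m(1,2) K(1)]) (simp_all add: marg)
  also have "\<dots> = (\<integral>\<^sup>+u. \<integral>\<^sup>+z. ennreal (G (u, z)) \<partial>K u \<partial>\<mu>)"
  proof (rule nn_integral_cong_AE, use K(2) in eventually_elim)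
    case (elim u)
    then have int: "integrable (K u) (\<lambda>z. G (u, z))" and "(\<integral>z. G (u, z) \<partial>K u) = 0"
      by (auto simp: G_def)
    then have *: "enn2real (\<integral>\<^sup>+z. ennreal (G (u, z)) \<partial>K u) = enn2real (\<integral>\<^sup>+z. ennreal (- G (u, z)) \<partial>K u)"
      by (simp add: real_lebesgue_integral_def)
    have "(\<integral>\<^sup>+z. ennreal (G (u, z)) \<partial>K u) \<noteq> \<infinity>" "(\<integral>\<^sup>+z. ennreal (- G (u, z)) \<partial>K u) \<noteq> \<infinity>"
      using int unfolding real_integrable_def by auto
    with * show ?case
      by (metis ennreal_enn2real infinity_ennreal_def less_top)
  qed
  also have "\<dots> = (\<integral>\<^sup>+w. ennreal (G w) \<partial>\<pi>)"
    using G_meas by (subst nn_integral_conditional_law[OF m(1,2) K(1)]) (simp_all add: marg)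
  finally have eq: "(\<integral>\<^sup>+w. ennreal (- G w) \<partial>\<pi>) = (\<integral>\<^sup>+w. ennreal (G w) \<partial>\<pi>)" .
  have "(\<integral>\<^sup>+w. ennreal (G w) \<partial>\<pi>) \<le> (\<integral>\<^sup>+w. ennreal (B w) \<partial>\<pi>)"
    using B(2) by (intro nn_integral_mono_AE) (auto simp: G_def intro: ennreal_leI)
  also have "\<dots> < \<infinity>"
    using B(1) unfolding real_integrable_def by (auto simp: less_top)
  finally have fin: "(\<integral>\<^sup>+w. ennreal (G w) \<partial>\<pi>) < \<infinity>" .
  show "integrable \<pi> (\<lambda>w. g (fst w) \<bullet> fst (snd w))"
    unfolding real_integrable_def G_def[symmetric] using fin eq by simp
  then show "(\<integral>w. g (fst w) \<bullet> fst (snd w) \<partial>\<pi>) = 0"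
    unfolding G_def[symmetric] using eq by (simp add: real_lebesgue_integral_def)
qed

lemma exponent_integral_coupling:
  assumes \<pi>: "\<pi> \<in> couplings \<mu> \<nu>" and fgh: "integrable \<mu> f" "integrable \<mu> g" "integrable \<nu> h"
    and g: "integrable \<pi> (\<lambda>w. g (fst w) \<bullet> fst (snd w))" "(\<integral>w. g (fst w) \<bullet> fst (snd w) \<partial>\<pi>) = 0"
  shows "integrable \<pi> (exponent f g h)"
    and "(\<integral>w. cost (fst w) (snd (snd w)) \<partial>\<pi>) + \<epsilon> * (\<integral>w. exponent f g h w \<partial>\<pi>)
      = (\<integral>u. f u \<partial>\<mu>) + (\<integral>z. h z \<partial>\<nu>)"
proof -
  note m = coupling_marginals[OF \<pi>]
  note I = m(5)[OF fgh(1)] m(7)[OF fgh(3)] m(9) g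
  have eq: "exponent f g h w = (f (fst w) + g (fst w) \<bullet> fst (snd w) + h (snd w)
      - cost (fst w) (snd (snd w))) / \<epsilon>" for w
    by (simp add: exponent_def potentials_def case_prod_beta)
  show "integrable \<pi> (exponent f g h)"
    unfolding eq[abs_def] using I by simp
  show "(\<integral>w. cost (fst w) (snd (snd w)) \<partial>\<pi>) + \<epsilon> * (\<integral>w. exponent f g h w \<partial>\<pi>)
      = (\<integral>u. f u \<partial>\<mu>) + (\<integral>z. h z \<partial>\<nu>)"
    unfolding eq using I m(6)[OF fgh(1)] m(8)[OF fgh(3)] \<epsilon>_pos by simp
qed

section \<open>The Gibbs measure of a minimiser\<close>

text \<open>First-order condition: under the Gibbs measure of a minimiser, nonnegative sums of potentials
  integrate to at most their integral with respect to \<open>R\<close>.\<close>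

lemma potentials_bounded_by_minimiser:
  assumes min: "is_minimiser f g h"
    and abk: "integrable \<mu> a" "integrable \<mu> b" "integrable \<nu> k"
    and nonneg: "\<And>w. 0 \<le> potentials a b k w"
  shows "(\<integral>\<^sup>+w. ennreal (potentials a b k w * exp (exponent f g h w)) \<partial>R)
    \<le> ennreal ((\<integral>u. a u \<partial>\<mu>) + (\<integral>z. k z \<partial>\<nu>))"
proof -
  note fgh = is_minimiserD(1-3)[OF min] and int = is_minimiserD(4)[OF min]
    and opt = is_minimiserD(5)[OF min]
  have "(\<integral>\<^sup>+w. ennreal (potentials a b k w * exp (exponent f g h w)) \<partial>R)
    \<le> ennreal (\<integral>w. potentials a b k w \<partial>R)"
  proof (rule R.minimiser_variational_inequality)
    fix \<delta> :: real
    assume "0 < \<delta>" and i: "integrable R (\<lambda>w. exp (exponent f g h w - \<delta> * potentials a b k w))"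
    have eq: "exponent f g h w - \<delta> * potentials a b k w
        = exponent (\<lambda>u. f u + (- (\<delta> * \<epsilon>)) * a u) (\<lambda>u. g u + (- (\<delta> * \<epsilon>)) *\<^sub>R b u)
            (\<lambda>z. h z + (- (\<delta> * \<epsilon>)) * k z) w" for w
      unfolding exponent_add_potentials using \<epsilon>_pos by simp
    show "(\<integral>w. exp (exponent f g h w) - exponent f g h w \<partial>R)
        \<le> (\<integral>w. exp (exponent f g h w - \<delta> * potentials a b k w)
            - (exponent f g h w - \<delta> * potentials a b k w) \<partial>R)"
      using i unfolding eq
      by (intro opt Bochner_Integration.integrable_add integrable_mult_right
        integrable_scaleR_right fgh abk)
  qed (use fgh int abk nonneg in \<open>auto intro: exponent_integrable potentials_integrable\<close>)
  then show ?thesis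
    by (simp add: potentials_integrable(2)[OF abk])
qed

lemma mass_ge_1_of_minimiser:
  assumes min: "is_minimiser f g h"
  shows "1 \<le> (\<integral>w. exp (exponent f g h w) \<partial>R)"
proof (rule R.minimiser_mass_ge_1)
  note fgh = is_minimiserD(1-3)[OF min] and int = is_minimiserD(4)[OF min]
    and opt = is_minimiserD(5)[OF min]
  show "integrable R (exponent f g h)" "integrable R (\<lambda>w. exp (exponent f g h w))"
    using fgh int by (auto intro: exponent_integrable)
  fix \<delta> :: real
  assume "0 < \<delta>" and i: "integrable R (\<lambda>w. exp (exponent f g h w + \<delta>))"
  have eq: "exponent f g h w + \<delta> = exponent (\<lambda>u. f u + \<delta> * \<epsilon>) g h w" for w
    using \<epsilon>_pos by (simp add: exponent_def potentials_def case_prod_beta field_simps)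
  show "(\<integral>w. exp (exponent f g h w) - exponent f g h w \<partial>R)
      \<le> (\<integral>w. exp (exponent f g h w + \<delta>) - (exponent f g h w + \<delta>) \<partial>R)"
    using i fgh unfolding eq by (intro opt) auto
qed

text \<open>The measure whose density with respect to \<open>R\<close> is the Gibbs density.\<close>

definition gibbs_measure :: "('u \<Rightarrow> real) \<Rightarrow> ('u \<Rightarrow> 'x) \<Rightarrow> ('x \<times> 'u \<Rightarrow> real) \<Rightarrow> ('u \<times> 'x \<times> 'u) measure"
  where "gibbs_measure f g h = density R (\<lambda>w. ennreal (gibbs_density \<epsilon> f g h w))"

text \<open>The first-order condition for indicator functions bounds both marginals of the Gibbs measure by
  \<open>\<mu>\<close> and \<open>\<nu>\<close>; equality follows since all of these are probability measures.\<close>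

lemma gibbs_measure_coupling:
  assumes min: "is_minimiser f g h"
  shows "gibbs_measure f g h \<in> couplings \<mu> \<nu>"
proof -
  note fgh = is_minimiserD(1-3)[OF min] and var = potentials_bounded_by_minimiser[OF min]
  note mass = mass_ge_1_of_minimiser[OF min]
  let ?Z = "\<lambda>w. exp (exponent f g h w)"
  let ?P = "gibbs_measure f g h"
  have P_def: "?P = density R (\<lambda>w. ennreal (?Z w))"
    by (simp add: gibbs_measure_def gibbs_density_eq)
  have t[measurable]: "exponent f g h \<in> borel_measurable R"
    using exponent_integrable[OF fgh] by auto
  have sets_P: "sets ?P = sets borel" unfolding P_def sets_density by (rule sets_R)
  have meas: "fst \<in> ?P \<rightarrow>\<^sub>M borel" "snd \<in> ?P \<rightarrow>\<^sub>M borel"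
    unfolding measurable_cong_sets[OF sets_P refl]
    by (auto intro!: borel_measurable_continuous_onI continuous_intros)
  have le1: "(\<integral>\<^sup>+w. ennreal (?Z w) \<partial>R) \<le> 1"
    using var[of "\<lambda>_. 1" "\<lambda>_. 0" "\<lambda>_. 0"] by (simp add: potentials_def case_prod_beta \<mu>.prob_space[simplified])
  have "integrable R ?Z"
    using mass not_integrable_integral_eq[of R ?Z] by (cases "integrable R ?Z") auto
  then have "(\<integral>\<^sup>+w. ennreal (?Z w) \<partial>R) = ennreal (\<integral>w. ?Z w \<partial>R)"
    by (intro nn_integral_eq_integral) auto
  with mass le1 have one: "(\<integral>\<^sup>+w. ennreal (?Z w) \<partial>R) = 1"
    by (intro antisym) (auto simp: ennreal_1[symmetric] simp del: ennreal_1 intro: ennreal_leI)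
  have prob_P: "prob_space ?P"
  proof (rule prob_spaceI)
    have "emeasure ?P (space R) = (\<integral>\<^sup>+w. ennreal (?Z w) * indicator (space R) w \<partial>R)"
      unfolding P_def by (rule emeasure_density[OF _ sets.top]) measurable
    then show "emeasure ?P (space ?P) = 1"
      by (simp add: one P_def)
  qed
  have "distr ?P borel fst = \<mu>"
  proof (rule prob_space_eqI_le)
    show "prob_space (distr ?P borel fst)" using prob_P meas(1) by (rule prob_space.prob_space_distr)
    fix A assume "A \<in> sets (distr ?P borel fst)"
    then have A: "A \<in> sets borel" by simp
    have "emeasure (distr ?P borel fst) A = (\<integral>\<^sup>+w. ennreal (?Z w) * indicator (fst -` A) w \<partial>R)"
      using A meas(1) measurable_sets[OF meas(1) A]
      by (simp add: emeasure_distr P_def emeasure_density)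
    also have "\<dots> = (\<integral>\<^sup>+w. ennreal (potentials (indicator A) (\<lambda>_. 0) (\<lambda>_. 0) w * ?Z w) \<partial>R)"
      by (intro nn_integral_cong) (auto simp: potentials_def case_prod_beta indicator_def)
    also have "\<dots> \<le> ennreal ((\<integral>u. indicator A u \<partial>\<mu>) + (\<integral>z. 0 \<partial>\<nu>))"
      using A by (intro var) (auto simp: potentials_def case_prod_beta less_top[symmetric])
    also have "\<dots> = emeasure \<mu> A"
      using A by (simp add: \<mu>.emeasure_eq_measure)
    finally show "emeasure (distr ?P borel fst) A \<le> emeasure \<mu> A" .
  qed (simp_all add: prob_\<mu>)
  moreover have "distr ?P borel snd = \<nu>"
  proof (rule prob_space_eqI_le)
    show "prob_space (distr ?P borel snd)" using prob_P meas(2) by (rule prob_space.prob_space_distr)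
    fix A assume "A \<in> sets (distr ?P borel snd)"
    then have A: "A \<in> sets borel" by simp
    have "emeasure (distr ?P borel snd) A = (\<integral>\<^sup>+w. ennreal (?Z w) * indicator (snd -` A) w \<partial>R)"
      using A meas(2) measurable_sets[OF meas(2) A]
      by (simp add: emeasure_distr P_def emeasure_density)
    also have "\<dots> = (\<integral>\<^sup>+w. ennreal (potentials (\<lambda>_. 0) (\<lambda>_. 0) (indicator A) w * ?Z w) \<partial>R)"
      by (intro nn_integral_cong) (auto simp: potentials_def case_prod_beta indicator_def)
    also have "\<dots> \<le> ennreal ((\<integral>u. 0 \<partial>\<mu>) + (\<integral>z. indicator A z \<partial>\<nu>))"
      using A by (intro var) (auto simp: potentials_def case_prod_beta less_top[symmetric])
    also have "\<dots> = emeasure \<nu> A"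
      using A by (simp add: \<nu>.emeasure_eq_measure)
    finally show "emeasure (distr ?P borel snd) A \<le> emeasure \<nu> A" .
  qed (simp_all add: prob_\<nu>)
  ultimately show ?thesis
    using prob_P sets_P by (simp add: couplings_def)
qed

text \<open>The function \<open>b \<bullet> x\<close>, restricted to \<open>u \<in> A\<close>, has no sign. Adding \<open>norm b * norm x\<close> makes it
  nonnegative, and this term has the same integral under the Gibbs measure and under \<open>R\<close> because
  the second marginals agree.\<close>

lemma gibbs_measure_set_integral_eq_0:
  assumes min: "is_minimiser f g h"
    and A: "A \<in> sets borel"
  shows "(\<integral>w. indicator A (fst w) * (b \<bullet> fst (snd w)) \<partial>gibbs_measure f g h) = 0"
proof -
  note fgh = is_minimiserD(1-3)[OF min] and var = potentials_bounded_by_minimiser[OF min]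
  note coup = gibbs_measure_coupling[OF min]
  let ?Z = "\<lambda>w. exp (exponent f g h w)"
  let ?P = "gibbs_measure f g h"
  let ?d = "\<lambda>w. indicator A (fst w) * (b \<bullet> fst (snd w)) :: real"
  have P_def: "?P = density R (\<lambda>w. ennreal (?Z w))"
    by (simp add: gibbs_measure_def gibbs_density_eq)
  note m = coupling_marginals[OF coup]
  have t[measurable]: "exponent f g h \<in> borel_measurable R"
    using exponent_integrable[OF fgh] by auto
  note A[measurable]
  have k: "integrable \<nu> (\<lambda>z. norm b * norm (fst z))"
    using integrable_fst_\<nu> by auto
  define N where "N w = norm b * norm (fst (snd w))" for w :: "'u \<times> 'x \<times> 'u"
  have N: "integrable ?P N" "(\<integral>w. N w \<partial>?P) = (\<integral>z. norm b * norm (fst z) \<partial>\<nu>)"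
    unfolding N_def using m(7)[OF k] m(8)[OF k] by auto
  have d_meas: "?d \<in> borel_measurable ?P"
    unfolding measurable_cong_sets[OF m(3) refl] by measurable
  have d_le: "\<bar>?d w\<bar> \<le> N w" for w
    using Cauchy_Schwarz_ineq2[of b "fst (snd w)"] by (auto simp: N_def indicator_def)
  have d: "integrable ?P ?d"
    by (rule Bochner_Integration.integrable_bound[OF N(1) d_meas])
       (intro AE_I2, simp only: real_norm_def, rule order_trans[OF d_le abs_ge_self])
  have step: "0 \<le> s * (\<integral>w. ?d w \<partial>?P)" if "\<bar>s\<bar> = 1" for s
  proof -
    have nonneg: "0 \<le> N w - s * ?d w" for w
    proof -
      have "s * ?d w \<le> \<bar>s * ?d w\<bar>" by (rule abs_ge_self)
      also have "\<dots> = \<bar>?d w\<bar>" using that by (simp add: abs_mult)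
      also have "\<dots> \<le> N w" by (rule d_le)
      finally show ?thesis by simp
    qed
    have I: "integrable ?P (\<lambda>w. N w - s * ?d w)"
      using N d by simp
    have "ennreal (\<integral>w. N w - s * ?d w \<partial>?P) = (\<integral>\<^sup>+w. ennreal (N w - s * ?d w) \<partial>?P)"
      using nonneg by (intro nn_integral_eq_integral[symmetric] I) auto
    also have "\<dots> = (\<integral>\<^sup>+w. ennreal (?Z w) * ennreal (N w - s * ?d w) \<partial>R)"
      unfolding P_def by (rule nn_integral_density) (unfold N_def, measurable)
    also have "\<dots> = (\<integral>\<^sup>+w. ennreal (potentials (\<lambda>_. 0) (\<lambda>u. (- s * indicator A u) *\<^sub>R b)
        (\<lambda>z. norm b * norm (fst z)) w * ?Z w) \<partial>R)"
      using nonneg by (intro nn_integral_cong)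
        (simp add: potentials_def case_prod_beta N_def ennreal_mult''[symmetric] algebra_simps)
    also have "\<dots> \<le> ennreal ((\<integral>u. 0 \<partial>\<mu>) + (\<integral>z. norm b * norm (fst z) \<partial>\<nu>))"
    proof (rule var)
      show "integrable \<mu> (\<lambda>u. (- s * indicator A u) *\<^sub>R b)"
        using A by (intro integrable_scaleR_left integrable_mult_right) (auto simp: less_top[symmetric])
      show "0 \<le> potentials (\<lambda>_. 0) (\<lambda>u. (- s * indicator A u) *\<^sub>R b) (\<lambda>z. norm b * norm (fst z)) w" for w
        using nonneg[of w] by (simp add: potentials_def case_prod_beta N_def algebra_simps)
    qed (use k in auto)
    finally have "(\<integral>w. N w - s * ?d w \<partial>?P) \<le> (\<integral>w. N w \<partial>?P)"
      by (subst (asm) ennreal_le_iff) (auto simp: N(2) intro!: Bochner_Integration.integral_nonneg)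
    then show ?thesis
      using N(1) d by simp
  qed
  from step[of 1] step[of "-1"] show ?thesis by simp
qed

lemma gibbs_measure_feasible:
  assumes min: "is_minimiser f g h"
  shows "gibbs_measure f g h \<in> feasible \<mu> \<nu>"
proof -
  note fgh = is_minimiserD(1-3)[OF min] and coup = gibbs_measure_coupling[OF min]
    and mart = gibbs_measure_set_integral_eq_0[OF min]
  let ?Z = "\<lambda>w. exp (exponent f g h w)"
  let ?P = "gibbs_measure f g h"
  have P_def: "?P = density R (\<lambda>w. ennreal (?Z w))"
    by (simp add: gibbs_measure_def gibbs_density_eq)
  note m = coupling_marginals[OF coup]
  have t[measurable]: "exponent f g h \<in> borel_measurable R"
    using exponent_integrable[OF fgh] by auto
  have marg: "distr ?P borel fst = \<mu>" using coup by (simp add: couplings_def)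
  have fst_P: "fst \<in> ?P \<rightarrow>\<^sub>M borel"
    unfolding measurable_cong_sets[OF m(2) refl]
    by (auto intro!: borel_measurable_continuous_onI continuous_intros)
  define \<phi> where "\<phi> u = (\<integral>\<^sup>+z. ennreal (?Z (u, z)) \<partial>\<nu>)" for u
  have [measurable]: "\<phi> \<in> borel_measurable \<mu>"
    unfolding \<phi>_def by (rule \<nu>.borel_measurable_nn_integral_fst) measurable
  have rect: "emeasure ?P (A \<times> B) = (\<integral>\<^sup>+u. indicator A u * (\<integral>\<^sup>+z. ennreal (?Z (u, z)) * indicator B z \<partial>\<nu>) \<partial>\<mu>)"
    if [measurable]: "A \<in> sets borel" "B \<in> sets borel" for A B
  proof -
    have AB: "A \<times> B \<in> sets R" using that by auto
    have "emeasure ?P (A \<times> B) = (\<integral>\<^sup>+w. ennreal (?Z w) * indicator (A \<times> B) w \<partial>R)"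
      unfolding P_def using AB by (intro emeasure_density) auto
    also have "\<dots> = (\<integral>\<^sup>+u. \<integral>\<^sup>+z. ennreal (?Z (u, z)) * indicator (A \<times> B) (u, z) \<partial>\<nu> \<partial>\<mu>)"
      using AB by (intro \<nu>.nn_integral_fst[symmetric]) measurable
    also have "\<dots> = (\<integral>\<^sup>+u. indicator A u * (\<integral>\<^sup>+z. ennreal (?Z (u, z)) * indicator B z \<partial>\<nu>) \<partial>\<mu>)"
      by (intro nn_integral_cong) (simp add: indicator_times indicator_def)
    finally show ?thesis .
  qed
  have "density \<mu> \<phi> = density \<mu> (\<lambda>_. 1)"
  proof (rule measure_eqI)
    fix A assume "A \<in> sets (density \<mu> \<phi>)"
    then have A: "A \<in> sets borel" by simp
    have "emeasure \<mu> A = emeasure ?P (A \<times> UNIV)"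
      using A fst_P by (subst marg[symmetric], subst emeasure_distr) (auto simp: m(4) intro!: arg_cong[of _ _ "emeasure ?P"])
    also have "\<dots> = (\<integral>\<^sup>+u. \<phi> u * indicator A u \<partial>\<mu>)"
      using rect[OF A, of UNIV] by (simp add: \<phi>_def mult.commute)
    finally show "emeasure (density \<mu> \<phi>) A = emeasure (density \<mu> (\<lambda>_. 1)) A"
      using A by (simp add: emeasure_density)
  qed simp
  then have \<phi>_1: "AE u in \<mu>. \<phi> u = 1"
    by (subst (asm) \<mu>.density_unique_iff) auto
  \<comment> \<open>On the null set where the section of the density is not normalised, \<open>K u\<close> is \<open>\<nu>\<close>.\<close>
  define K where "K u = density \<nu> (\<lambda>z. if \<phi> u = 1 then ennreal (?Z (u, z)) else 1)" for u
  have Z_sec[measurable]: "(\<lambda>z. ?Z (u, z)) \<in> borel_measurable \<nu>" for u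
    by measurable
  have emeasure_K: "emeasure (K u) B = (\<integral>\<^sup>+z. (if \<phi> u = 1 then ennreal (?Z (u, z)) else 1) * indicator B z \<partial>\<nu>)"
    if "B \<in> sets borel" for u B
    unfolding K_def using that by (subst emeasure_density) auto
  have "K \<in> borel \<rightarrow>\<^sub>M prob_algebra borel"
  proof (rule measurable_prob_algebraI)
    show prob_K: "prob_space (K u)" for u
    proof (cases "\<phi> u = 1")
      case True
      then show ?thesis
        by (intro prob_spaceI) (simp add: K_def emeasure_density, simp add: \<phi>_def)
    next
      case False
      then have "K u = \<nu>" by (simp add: K_def density_1)
      then show ?thesis by (simp add: prob_\<nu>)
    qed
    show "K \<in> borel \<rightarrow>\<^sub>M subprob_algebra borel"
    proof (rule measurable_subprob_algebra)
      show "subprob_space (K u)" for u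
        using prob_K by (rule prob_space_imp_subprob_space)
      show "sets (K u) = sets borel" for u by (simp add: K_def)
      fix B :: "('x \<times> 'u) set" assume B: "B \<in> sets borel"
      have "(\<lambda>u. \<integral>\<^sup>+z. (if \<phi> (fst (u, z)) = 1 then ennreal (?Z (u, z)) else 1) * indicator B (snd (u, z)) \<partial>\<nu>)
          \<in> borel_measurable \<mu>"
        using B by measurable
      then show "(\<lambda>u. emeasure (K u) B) \<in> borel_measurable borel"
        using B by (simp add: emeasure_K)
    qed
  qed
  moreover have "emeasure ?P (A \<times> B) = (\<integral>\<^sup>+u\<in>A. emeasure (K u) B \<partial>distr ?P borel fst)"
    if "A \<in> sets borel" "B \<in> sets borel" for A B
    unfolding rect[OF that] marg
    by (intro nn_integral_cong_AE, use \<phi>_1 in eventually_elim)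
       (simp add: emeasure_K that mult.commute)
  ultimately have law: "is_conditional_law ?P K"
    by (simp add: is_conditional_law_def)
  define \<psi> where "\<psi> i u = (\<integral>z. ?Z (u, z) * (i \<bullet> fst z) \<partial>\<nu>)" for i u
  have int_i: "integrable R (\<lambda>w. ?Z w * (i \<bullet> fst (snd w)))" for i
  proof -
    have "integrable \<nu> (\<lambda>z. i \<bullet> fst z)" using integrable_fst_\<nu> by simp
    from m(7)[OF this] have "integrable ?P (\<lambda>w. i \<bullet> fst (snd w))" .
    then show ?thesis
      unfolding P_def by (subst (asm) integrable_density) auto
  qed
  have \<psi>_0: "AE u in \<mu>. \<psi> i u = 0" for i
  proof -
    have "AE u in \<mu>. \<psi> i u = (\<lambda>_. 0) u"
    proof (rule density_unique_real)
      show "integrable \<mu> (\<psi> i)"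
        unfolding \<psi>_def using R.integrable_fst'[OF int_i[of i]] by simp
      fix A assume "A \<in> sets \<mu>"
      then have A[measurable]: "A \<in> sets borel" by simp
      have int_A: "integrable R (\<lambda>w. indicator A (fst w) * (?Z w * (i \<bullet> fst (snd w))))"
        by (rule Bochner_Integration.integrable_bound[OF int_i[of i]])
           (auto intro!: AE_I2 simp: indicator_def)
      have "0 = (\<integral>w. ?Z w *\<^sub>R (indicator A (fst w) * (i \<bullet> fst (snd w))) \<partial>R)"
        using mart[OF A, of i] unfolding P_def by (subst (asm) integral_density) auto
      also have "\<dots> = (\<integral>w. indicator A (fst w) * (?Z w * (i \<bullet> fst (snd w))) \<partial>R)"
        by (intro Bochner_Integration.integral_cong) auto
      also have "\<dots> = (\<integral>u. \<integral>z. indicator A u * (?Z (u, z) * (i \<bullet> fst z)) \<partial>\<nu> \<partial>\<mu>)"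
        using R.integral_fst'[OF int_A] by simp
      also have "\<dots> = (\<integral>u\<in>A. \<psi> i u \<partial>\<mu>)"
        by (simp add: set_lebesgue_integral_def \<psi>_def)
      finally show "(\<integral>u\<in>A. \<psi> i u \<partial>\<mu>) = (\<integral>u\<in>A. 0 \<partial>\<mu>)" by simp
    qed simp
    then show ?thesis by simp
  qed
  then have "AE u in \<mu>. \<forall>i\<in>Basis. \<psi> i u = 0"
    by (intro AE_ball_countable[THEN iffD2]) (auto intro: countable_finite)
  moreover have "AE u in \<mu>. integrable \<nu> (\<lambda>z. ?Z (u, z) * norm (fst z))"
  proof -
    have "integrable \<nu> (\<lambda>z. norm (fst z))" using integrable_fst_\<nu> by simp
    from m(7)[OF this] have "integrable ?P (\<lambda>w. norm (fst (snd w)))" .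
    then have "integrable R (\<lambda>w. ?Z w * norm (fst (snd w)))"
      unfolding P_def by (subst (asm) integrable_density) auto
    from R.AE_integrable_fst'[OF this] show ?thesis by simp
  qed
  ultimately have "AE u in \<mu>. integrable (K u) fst \<and> (\<integral>z. fst z \<partial>K u) = 0"
    using \<phi>_1
  proof eventually_elim
    case (elim u)
    have K_eq: "K u = density \<nu> (\<lambda>z. ennreal (?Z (u, z)))"
      using elim(3) by (simp add: K_def)
    have "integrable (K u) (\<lambda>z. norm (fst z))"
      unfolding K_eq by (subst integrable_density) (use elim(2) in auto)
    then have int: "integrable (K u) fst"
      by (subst (asm) integrable_norm_iff) (auto simp: K_def)
    have "(\<integral>z. fst z \<partial>K u) \<bullet> i = 0" if "i \<in> Basis" for i
    proof -
      have "(\<integral>z. fst z \<partial>K u) \<bullet> i = (\<integral>z. fst z \<bullet> i \<partial>K u)"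
        using int by simp
      also have "\<dots> = \<psi> i u"
        unfolding K_eq \<psi>_def by (subst integral_density) (auto simp: inner_commute)
      finally show ?thesis using elim(1) that by simp
    qed
    then have "(\<integral>z. fst z \<partial>K u) = 0"
      by (intro euclidean_eqI[where 'a = 'x]) simp
    with int show ?case by simp
  qed
  moreover have "(\<lambda>(x, y). x) = (fst :: 'x \<times> 'u \<Rightarrow> 'x)" by auto
  ultimately have "AE u in \<mu>. integrable (K u) fst \<and> (\<integral>(x, y). x \<partial>K u) = 0"
    by (simp only:)
  with law coup show ?thesis
    unfolding feasible_def by blast
qed

section \<open>Duality\<close>

text \<open>With \<open>t\<close> the exponent and \<open>D\<close> the density of \<open>\<pi>\<close>, the duality gap is at least
  \<open>\<epsilon> \<integral> exp y - 1 - y \<partial>\<pi>\<close> for \<open>y = t - ln D\<close>. The integrand is nonnegative and vanishes only for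
  \<open>y = 0\<close>, which also gives uniqueness of the optimal coupling.\<close>

lemma weak_duality_KL:
  assumes \<pi>: "\<pi> \<in> feasible \<mu> \<nu>" and ac: "absolutely_continuous R \<pi>"
    and ent: "integrable \<pi> (entropy_density (exp 1) R \<pi>)"
    and fgh: "integrable \<mu> f" "integrable \<mu> g" "integrable \<nu> h"
    and Z: "integrable R (gibbs_density \<epsilon> f g h)"
  defines "primal \<equiv> (\<integral>w. cost (fst w) (snd (snd w)) \<partial>\<pi>) + \<epsilon> * KL_divergence (exp 1) R \<pi>"
    and "dual \<equiv> (\<integral>u. f u \<partial>\<mu>) + (\<integral>z. h z \<partial>\<nu>)
      - \<epsilon> * (\<integral>w. gibbs_density \<epsilon> f g h w \<partial>R) + \<epsilon>"
  shows "dual \<le> primal"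
    and "\<lbrakk>primal \<le> dual; prob_space (gibbs_measure f g h)\<rbrakk> \<Longrightarrow> \<pi> = gibbs_measure f g h"
proof -
  have coup: "\<pi> \<in> couplings \<mu> \<nu>" using \<pi> by (simp add: feasible_def)
  note m = coupling_marginals[OF coup]
  interpret \<pi>: prob_space \<pi> by (rule m(1))
  define t where "t = exponent f g h"
  have Z_eq: "gibbs_density \<epsilon> f g h = (\<lambda>w. exp (t w))"
    by (simp add: gibbs_density_eq t_def fun_eq_iff)
  have t_meas[measurable]: "t \<in> borel_measurable R"
    unfolding t_def using exponent_integrable[OF fgh] by auto
  have t_meas\<pi>[measurable]: "t \<in> borel_measurable \<pi>"
    using t_meas measurable_cong_sets[OF m(3) refl] by blast
  obtain D where D[measurable]: "D \<in> borel_measurable R"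
    and D_RN: "AE w in R. RN_deriv R \<pi> w = ennreal (D w)"
    and D_pos: "AE w in \<pi>. 0 < D w" and D_nonneg: "\<And>w. 0 \<le> D w"
    by (rule R.real_RN_deriv[OF \<pi>.finite_measure_axioms ac m(3)]) blast
  have D_meas\<pi>[measurable]: "D \<in> borel_measurable \<pi>"
    using D measurable_cong_sets[OF m(3) refl] by blast
  have dens: "density R (\<lambda>w. ennreal (D w)) = \<pi>"
  proof -
    have "density R (RN_deriv R \<pi>) = \<pi>"
      using ac m(3) by (rule R.density_RN_deriv)
    moreover have "density R (RN_deriv R \<pi>) = density R (\<lambda>w. ennreal (D w))"
      using D_RN by (intro density_cong) auto
    ultimately show ?thesis by simp
  qed
  have D_RN\<pi>: "AE w in \<pi>. RN_deriv R \<pi> w = ennreal (D w)"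
    using m(3) ac D_RN by (intro absolutely_continuous_AE[OF m(3) ac]) auto
  have ent_eq: "AE w in \<pi>. entropy_density (exp 1) R \<pi> w = ln (D w)"
    using D_RN\<pi> by eventually_elim (simp add: entropy_density_def log_def D_nonneg)
  have ent_meas: "entropy_density (exp 1) R \<pi> \<in> borel_measurable \<pi>"
    using ent by auto
  have l: "integrable \<pi> (\<lambda>w. ln (D w))"
    using ent by (rule integrable_cong_AE_imp) (use ent_eq in auto)
  have KL_eq: "KL_divergence (exp 1) R \<pi> = (\<integral>w. ln (D w) \<partial>\<pi>)"
    unfolding KL_divergence_def using ent_eq ent_meas by (intro integral_cong_AE) auto
  have "(\<integral>\<^sup>+w. ennreal (exp (t w - ln (D w))) \<partial>\<pi>)
      = (\<integral>\<^sup>+w. ennreal (D w) * ennreal (exp (t w - ln (D w))) \<partial>R)"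
    unfolding dens[symmetric] by (rule nn_integral_density) measurable
  also have "\<dots> \<le> (\<integral>\<^sup>+w. ennreal (exp (t w)) \<partial>R)"
  proof (intro nn_integral_mono)
    fix w
    show "ennreal (D w) * ennreal (exp (t w - ln (D w))) \<le> ennreal (exp (t w))"
      using D_nonneg[of w]
      by (cases "D w = 0") (simp_all add: exp_diff ennreal_mult'[symmetric])
  qed
  also have "\<dots> = ennreal (\<integral>w. exp (t w) \<partial>R)"
    using Z by (intro nn_integral_eq_integral) (auto simp: Z_eq)
  finally have nn_E: "(\<integral>\<^sup>+w. ennreal (exp (t w - ln (D w))) \<partial>\<pi>) \<le> ennreal (\<integral>w. exp (t w) \<partial>R)" .
  have E: "integrable \<pi> (\<lambda>w. exp (t w - ln (D w)))"
    using nn_E by (intro integrableI_nonneg) (auto simp: less_top[symmetric] top_unique)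
  have E_le: "(\<integral>w. exp (t w - ln (D w)) \<partial>\<pi>) \<le> (\<integral>w. exp (t w) \<partial>R)"
    using nn_E unfolding nn_integral_eq_integral[OF E AE_I2[OF exp_ge_zero]]
    by (subst (asm) ennreal_le_iff) (auto intro!: Bochner_Integration.integral_nonneg)
  have g: "integrable \<pi> (\<lambda>w. g (fst w) \<bullet> fst (snd w))" "(\<integral>w. g (fst w) \<bullet> fst (snd w) \<partial>\<pi>) = 0"
  proof -
    \<comment> \<open>The inequality \<open>y \<le> exp y\<close> bounds the exponent, hence \<open>g u \<bullet> x\<close>, from above.\<close>
    let ?B = "\<lambda>w. \<epsilon> * (ln (D w) + exp (t w - ln (D w))) - f (fst w) - h (snd w) + cost (fst w) (snd (snd w))"
    have B: "integrable \<pi> ?B"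
      using l E m(5)[OF fgh(1)] m(7)[OF fgh(3)] m(9) by simp
    have le: "g (fst w) \<bullet> fst (snd w) \<le> ?B w" for w
    proof -
      have "t w \<le> ln (D w) + exp (t w - ln (D w))"
        using exp_ge_add_one_self[of "t w - ln (D w)"] by linarith
      then have "\<epsilon> * t w \<le> \<epsilon> * (ln (D w) + exp (t w - ln (D w)))"
        using \<epsilon>_pos by (intro mult_left_mono) auto
      moreover have "\<epsilon> * t w = f (fst w) + g (fst w) \<bullet> fst (snd w) + h (snd w) - cost (fst w) (snd (snd w))"
        using \<epsilon>_pos by (simp add: t_def exponent_def potentials_def case_prod_beta)
      ultimately show ?thesis by linarith
    qed
    show "integrable \<pi> (\<lambda>w. g (fst w) \<bullet> fst (snd w))" "(\<integral>w. g (fst w) \<bullet> fst (snd w) \<partial>\<pi>) = 0"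
      using martingale_integral[OF \<pi> integrable_borel(1)[OF fgh(2)] B] le by auto
  qed
  have t: "integrable \<pi> t"
    unfolding t_def by (rule exponent_integral_coupling(1)[OF coup fgh g])
  have sum: "(\<integral>w. cost (fst w) (snd (snd w)) \<partial>\<pi>) + \<epsilon> * (\<integral>w. t w \<partial>\<pi>)
      = (\<integral>u. f u \<partial>\<mu>) + (\<integral>z. h z \<partial>\<nu>)"
    unfolding t_def by (rule exponent_integral_coupling(2)[OF coup fgh g])
  define r where "r w = exp (t w - ln (D w)) - 1 - (t w - ln (D w))" for w
  have r_nonneg: "0 \<le> r w" for w
    using exp_ge_add_one_self[of "t w - ln (D w)"] unfolding r_def by linarith
  have r_int: "integrable \<pi> r"
    unfolding r_def using E t l by simp
  have r_eq: "(\<integral>w. r w \<partial>\<pi>) = (\<integral>w. exp (t w - ln (D w)) \<partial>\<pi>) - 1 - ((\<integral>w. t w \<partial>\<pi>) - (\<integral>w. ln (D w) \<partial>\<pi>))"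
    unfolding r_def using E t l by (simp add: \<pi>.prob_space)
  have gap: "\<epsilon> * (\<integral>w. r w \<partial>\<pi>) \<le> primal - dual"
  proof -
    have "(\<integral>w. r w \<partial>\<pi>) \<le> (\<integral>w. exp (t w) \<partial>R) - 1 - ((\<integral>w. t w \<partial>\<pi>) - (\<integral>w. ln (D w) \<partial>\<pi>))"
      unfolding r_eq using E_le by simp
    then have "\<epsilon> * (\<integral>w. r w \<partial>\<pi>)
        \<le> \<epsilon> * ((\<integral>w. exp (t w) \<partial>R) - 1 - ((\<integral>w. t w \<partial>\<pi>) - (\<integral>w. ln (D w) \<partial>\<pi>)))"
      using \<epsilon>_pos by (intro mult_left_mono) auto
    also have "\<dots> = primal - dual"
      unfolding primal_def dual_def KL_eq Z_eq sum[symmetric] by (simp add: algebra_simps)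
    finally show ?thesis .
  qed
  have r_int_nonneg: "0 \<le> (\<integral>w. r w \<partial>\<pi>)"
    using r_nonneg by (rule Bochner_Integration.integral_nonneg)
  show "dual \<le> primal"
    using gap mult_nonneg_nonneg[OF less_imp_le[OF \<epsilon>_pos] r_int_nonneg] by linarith
  assume le: "primal \<le> dual" and prob: "prob_space (gibbs_measure f g h)"
  have "\<epsilon> * (\<integral>w. r w \<partial>\<pi>) \<le> 0" using gap le by linarith
  then have "(\<integral>w. r w \<partial>\<pi>) = 0"
    using \<epsilon>_pos r_int_nonneg by (simp add: mult_le_0_iff)
  then have "AE w in \<pi>. r w = 0"
    using r_int r_nonneg by (subst (asm) integral_nonneg_eq_0_iff_AE) auto
  then have t_eq: "AE w in \<pi>. ennreal (exp (t w)) = ennreal (D w)"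
    using D_pos
  proof eventually_elim
    case (elim w)
    then have "exp (t w - ln (D w)) = 1 + (t w - ln (D w))"
      unfolding r_def by linarith
    then have "t w = ln (D w)"
      unfolding exp_eq_add_one_self_iff by simp
    with elim(2) show ?case by simp
  qed
  have t_eq_R: "AE w in R. 0 < D w \<longrightarrow> ennreal (exp (t w)) = ennreal (D w)"
  proof -
    have "AE w in density R (\<lambda>w. ennreal (D w)). ennreal (exp (t w)) = ennreal (D w)"
      using t_eq unfolding dens .
    then show ?thesis
      by (subst (asm) AE_density) (auto simp: ennreal_eq_0_iff)
  qed
  show "\<pi> = gibbs_measure f g h"
  proof (rule prob_space_eqI_le[OF m(1) prob])
    show "sets \<pi> = sets (gibbs_measure f g h)" by (simp add: gibbs_measure_def m(3))
    fix A assume "A \<in> sets \<pi>"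
    then have A: "A \<in> sets R" by (simp add: m(3))
    have "emeasure \<pi> A = (\<integral>\<^sup>+w. ennreal (D w) * indicator A w \<partial>R)"
      using A by (subst dens[symmetric], subst emeasure_density) auto
    also have "\<dots> \<le> (\<integral>\<^sup>+w. ennreal (exp (t w)) * indicator A w \<partial>R)"
    proof (rule nn_integral_mono_AE, use t_eq_R in eventually_elim)
      case (elim w)
      then show ?case using D_nonneg[of w] by (cases "D w = 0") (auto simp: indicator_def)
    qed
    also have "\<dots> = emeasure (gibbs_measure f g h) A"
      using A by (simp add: gibbs_measure_def Z_eq emeasure_density)
    finally show "emeasure \<pi> A \<le> emeasure (gibbs_measure f g h) A" .
  qed
qed

lemma primal_objective_eq:
  assumes "\<pi> \<in> feasible \<mu> \<nu>"
  shows "primal_objective \<epsilon> \<mu> \<nu> \<pi> =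
    (if absolutely_continuous R \<pi> \<and> integrable \<pi> (entropy_density (exp 1) R \<pi>)
     then ereal ((\<integral>w. cost (fst w) (snd (snd w)) \<partial>\<pi>) + \<epsilon> * KL_divergence (exp 1) R \<pi>) else \<infinity>)"
proof -
  have coup: "\<pi> \<in> couplings \<mu> \<nu>" using assms by (simp add: feasible_def)
  have "(\<integral>\<^sup>+(u, x, y). ennreal (cost u y) \<partial>\<pi>) = ennreal (\<integral>w. cost (fst w) (snd (snd w)) \<partial>\<pi>)"
  proof -
    have "(\<lambda>(u, x, y). ennreal (cost u y))
        = (\<lambda>w :: 'u \<times> 'x \<times> 'u. ennreal (cost (fst w) (snd (snd w))))"
      by (simp add: fun_eq_iff)
    then show ?thesis
      using nn_integral_eq_integral[OF coupling_marginals(9)[OF coup]]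
      by (simp only: cost_nonneg AE_I2)
  qed
  then have "enn2ereal (\<integral>\<^sup>+(u, x, y). ennreal (cost u y) \<partial>\<pi>) = ereal (\<integral>w. cost (fst w) (snd (snd w)) \<partial>\<pi>)"
    by (simp add: enn2ereal_ennreal Bochner_Integration.integral_nonneg cost_nonneg)
  then show ?thesis
    unfolding primal_objective_def KL_def using \<epsilon>_pos by simp
qed

lemma dual_objective_eq:
  assumes "integrable R (gibbs_density \<epsilon> f g h)"
  shows "dual_objective \<epsilon> \<mu> \<nu> f g h = ereal ((\<integral>u. f u \<partial>\<mu>) + (\<integral>z. h z \<partial>\<nu>)
      - \<epsilon> * (\<integral>w. gibbs_density \<epsilon> f g h w \<partial>R) + \<epsilon>)"
proof -
  have nonneg: "0 \<le> gibbs_density \<epsilon> f g h w" for w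
    by (simp add: gibbs_density_eq)
  have "(\<integral>\<^sup>+w. ennreal (gibbs_density \<epsilon> f g h w) \<partial>R) = ennreal (\<integral>w. gibbs_density \<epsilon> f g h w \<partial>R)"
    using assms nonneg by (intro nn_integral_eq_integral) auto
  then show ?thesis
    unfolding dual_objective_def
    by (simp add: enn2ereal_ennreal Bochner_Integration.integral_nonneg nonneg)
qed

lemma measurable_gibbs_density:
  assumes "integrable \<mu> f" "integrable \<mu> g" "integrable \<nu> h"
  shows "gibbs_density \<epsilon> f g h \<in> borel_measurable R"
proof -
  have [measurable]: "exponent f g h \<in> borel_measurable R"
    using exponent_integrable[OF assms] by auto
  have "(\<lambda>w. exp (exponent f g h w)) \<in> borel_measurable R" by measurable
  then show ?thesis by (simp add: gibbs_density_eq[abs_def])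
qed

lemma weak_duality:
  assumes \<pi>: "\<pi> \<in> feasible \<mu> \<nu>" and fgh: "integrable \<mu> f" "integrable \<mu> g" "integrable \<nu> h"
  shows "dual_objective \<epsilon> \<mu> \<nu> f g h \<le> primal_objective \<epsilon> \<mu> \<nu> \<pi>"
proof (cases "integrable R (gibbs_density \<epsilon> f g h)")
  case True
  then show ?thesis
    using weak_duality_KL(1)[OF \<pi> _ _ fgh True]
    by (simp add: primal_objective_eq[OF \<pi>] dual_objective_eq)
next
  case False
  have "(\<integral>\<^sup>+w. ennreal (gibbs_density \<epsilon> f g h w) \<partial>R) = \<infinity>"
  proof (rule ccontr)
    assume "(\<integral>\<^sup>+w. ennreal (gibbs_density \<epsilon> f g h w) \<partial>R) \<noteq> \<infinity>"
    then have "integrable R (gibbs_density \<epsilon> f g h)"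
      by (intro integrableI_nonneg measurable_gibbs_density fgh)
         (auto simp: gibbs_density_eq less_top[symmetric])
    with False show False ..
  qed
  then show ?thesis
    unfolding dual_objective_def using \<epsilon>_pos by simp
qed

lemma primal_objective_gibbs_measure:
  assumes feas: "gibbs_measure f g h \<in> feasible \<mu> \<nu>"
    and fgh: "integrable \<mu> f" "integrable \<mu> g" "integrable \<nu> h"
  shows "primal_objective \<epsilon> \<mu> \<nu> (gibbs_measure f g h) = ereal ((\<integral>u. f u \<partial>\<mu>) + (\<integral>z. h z \<partial>\<nu>))"
    and "AE w in R. RN_deriv R (gibbs_measure f g h) w = ennreal (gibbs_density \<epsilon> f g h w)"
    and "integrable R (gibbs_density \<epsilon> f g h)" "(\<integral>w. gibbs_density \<epsilon> f g h w \<partial>R) = 1"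
proof -
  let ?P = "gibbs_measure f g h"
  have coup: "?P \<in> couplings \<mu> \<nu>" using feas by (simp add: feasible_def)
  note m = coupling_marginals[OF coup]
  interpret P: prob_space ?P by (rule m(1))
  note Z_meas[measurable] = measurable_gibbs_density[OF fgh]
  have t[measurable]: "exponent f g h \<in> borel_measurable R"
    using exponent_integrable[OF fgh] by auto
  have one: "(\<integral>\<^sup>+w. ennreal (gibbs_density \<epsilon> f g h w) \<partial>R) = 1"
  proof -
    have "emeasure ?P (space R) = (\<integral>\<^sup>+w. ennreal (gibbs_density \<epsilon> f g h w) * indicator (space R) w \<partial>R)"
      unfolding gibbs_measure_def by (rule emeasure_density[OF _ sets.top]) measurable
    then show ?thesis
      using P.emeasure_space_1 by (simp add: m(4))
  qed
  show int_Z: "integrable R (gibbs_density \<epsilon> f g h)"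
    using one by (intro integrableI_nonneg) (auto simp: gibbs_density_eq)
  show "(\<integral>w. gibbs_density \<epsilon> f g h w \<partial>R) = 1"
    using one by (subst integral_eq_nn_integral) (auto simp: gibbs_density_eq)
  have ac: "absolutely_continuous R ?P"
    unfolding gibbs_measure_def by (intro absolutely_continuousI_density) measurable
  show RN: "AE w in R. RN_deriv R ?P w = ennreal (gibbs_density \<epsilon> f g h w)"
  proof -
    have "AE w in R. ennreal (gibbs_density \<epsilon> f g h w) = RN_deriv R ?P w"
      unfolding gibbs_measure_def by (rule R.RN_deriv_unique[OF _ refl]) measurable
    then show ?thesis by eventually_elim (rule sym)
  qed
  have RN': "AE w in ?P. RN_deriv R ?P w = ennreal (gibbs_density \<epsilon> f g h w)"
    using RN by (intro absolutely_continuous_AE[OF m(3) ac]) auto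
  then have ent_eq: "AE w in ?P. entropy_density (exp 1) R ?P w = exponent f g h w"
    by eventually_elim (simp add: entropy_density_def log_def gibbs_density_eq)
  have g: "integrable ?P (\<lambda>w. g (fst w) \<bullet> fst (snd w))" "(\<integral>w. g (fst w) \<bullet> fst (snd w) \<partial>?P) = 0"
  proof -
    \<comment> \<open>Since \<open>- t * exp t \<le> 1\<close>, the negative part of the exponent is integrable under the Gibbs
      measure, which bounds \<open>- (g u \<bullet> x)\<close> from above.\<close>
    define s where "s w = max 0 (- exponent f g h w)" for w
    have [measurable]: "s \<in> borel_measurable R" unfolding s_def by measurable
    have "integrable R (\<lambda>w. gibbs_density \<epsilon> f g h w * s w)"
    proof (rule R.integrable_const_bound[of _ 1])
      have "\<bar>gibbs_density \<epsilon> f g h w * s w\<bar> \<le> 1" for w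
        using minus_mult_exp_le_1[of "exponent f g h w"]
        by (auto simp: s_def gibbs_density_eq max_def mult.commute abs_mult)
      then show "AE w in R. norm (gibbs_density \<epsilon> f g h w * s w) \<le> 1" by simp
    qed measurable
    then have s_int: "integrable ?P s"
      unfolding gibbs_measure_def by (subst integrable_density) (auto simp: gibbs_density_eq)
    let ?B = "\<lambda>w. \<epsilon> * s w + f (fst w) + h (snd w) - cost (fst w) (snd (snd w))"
    have B: "integrable ?P ?B"
      using s_int m(5)[OF fgh(1)] m(7)[OF fgh(3)] m(9) by simp
    have le: "(- g (fst w)) \<bullet> fst (snd w) \<le> ?B w" for w
    proof -
      have "\<epsilon> * (- exponent f g h w) \<le> \<epsilon> * s w"
        using \<epsilon>_pos by (intro mult_left_mono) (auto simp: s_def)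
      moreover have "\<epsilon> * exponent f g h w
          = f (fst w) + g (fst w) \<bullet> fst (snd w) + h (snd w) - cost (fst w) (snd (snd w))"
        using \<epsilon>_pos by (simp add: exponent_def potentials_def case_prod_beta)
      ultimately show ?thesis by simp
    qed
    have [measurable]: "(\<lambda>u. - g u) \<in> borel_measurable borel"
      using integrable_borel(1)[OF fgh(2)] by simp
    note * = martingale_integral[OF feas this B] le
    show "integrable ?P (\<lambda>w. g (fst w) \<bullet> fst (snd w))" "(\<integral>w. g (fst w) \<bullet> fst (snd w) \<partial>?P) = 0"
      using * by auto
  qed
  note T = exponent_integral_coupling[OF coup fgh g]
  have ent_meas: "entropy_density (exp 1) R ?P \<in> borel_measurable ?P"
    unfolding measurable_cong_sets[OF m(3) refl] by (rule measurable_entropy_density)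
  have ent: "integrable ?P (entropy_density (exp 1) R ?P)"
  proof (rule integrable_cong_AE_imp[OF T(1) ent_meas])
    show "AE w in ?P. exponent f g h w = entropy_density (exp 1) R ?P w"
      using ent_eq by eventually_elim (rule sym)
  qed
  have "KL_divergence (exp 1) R ?P = (\<integral>w. exponent f g h w \<partial>?P)"
    unfolding KL_divergence_def using ent_eq ent_meas T(1) by (intro integral_cong_AE) auto
  then show "primal_objective \<epsilon> \<mu> \<nu> ?P = ereal ((\<integral>u. f u \<partial>\<mu>) + (\<integral>z. h z \<partial>\<nu>))"
    using primal_objective_eq[OF feas] ac ent T(2) by simp
qed

lemma strong_duality_and_attainment:
  "primal_value \<epsilon> \<mu> \<nu> = dual_value \<epsilon> \<mu> \<nu> \<and>
    (\<exists>\<pi>. primal_solutions \<epsilon> \<mu> \<nu> = {\<pi>} \<and>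
      (\<exists>f g h. integrable \<mu> f \<and> integrable \<mu> g \<and> integrable \<nu> h \<and>
        (AE w in R. RN_deriv R \<pi> w = ennreal (gibbs_density \<epsilon> f g h w)) \<and>
        dual_objective \<epsilon> \<mu> \<nu> f g h = dual_value \<epsilon> \<mu> \<nu> \<and>
        primal_value \<epsilon> \<mu> \<nu> = ereal ((\<integral>u. f u \<partial>\<mu>) + (\<integral>z. h z \<partial>\<nu>))))"
proof -
  obtain f g h where min: "is_minimiser f g h"
    by (rule exists_minimiser)
  note fgh = is_minimiserD(1-3)[OF min]
  let ?P = "gibbs_measure f g h"
  let ?v = "ereal ((\<integral>u. f u \<partial>\<mu>) + (\<integral>z. h z \<partial>\<nu>))"
  note coup = gibbs_measure_coupling[OF min] and feas = gibbs_measure_feasible[OF min]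
  note P = primal_objective_gibbs_measure[OF feas fgh]
  have dual_fgh: "dual_objective \<epsilon> \<mu> \<nu> f g h = ?v"
    by (simp add: dual_objective_eq[OF P(3)] P(4))
  have primal_ge: "?v \<le> primal_objective \<epsilon> \<mu> \<nu> \<pi>" if "\<pi> \<in> feasible \<mu> \<nu>" for \<pi>
    using weak_duality[OF that fgh] by (simp add: dual_fgh)
  have primal: "primal_value \<epsilon> \<mu> \<nu> = ?v"
    unfolding primal_value_def
    by (intro antisym INF_lower2[OF feas] INF_greatest primal_ge) (simp add: P(1))
  have dual: "dual_value \<epsilon> \<mu> \<nu> = ?v"
  proof (rule antisym)
    show "dual_value \<epsilon> \<mu> \<nu> \<le> ?v"
      unfolding dual_value_def using weak_duality[OF feas] by (auto intro!: SUP_least simp: P(1))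
    show "?v \<le> dual_value \<epsilon> \<mu> \<nu>"
      unfolding dual_value_def using fgh by (intro SUP_upper2[of "(f, g, h)"]) (auto simp: dual_fgh)
  qed
  have unique: "\<pi> = ?P" if "\<pi> \<in> primal_solutions \<epsilon> \<mu> \<nu>" for \<pi>
  proof -
    have feas_\<pi>: "\<pi> \<in> feasible \<mu> \<nu>" and obj: "primal_objective \<epsilon> \<mu> \<nu> \<pi> = ?v"
      using that by (auto simp: primal_solutions_def primal)
    then have fin: "absolutely_continuous R \<pi>" "integrable \<pi> (entropy_density (exp 1) R \<pi>)"
      by (auto simp: primal_objective_eq split: if_splits)
    have "prob_space ?P" using coup by (rule coupling_marginals(1))
    then show ?thesis
      using obj fin by (intro weak_duality_KL(2)[OF feas_\<pi> fin fgh P(3)])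
        (simp_all add: primal_objective_eq[OF feas_\<pi>] P(4))
  qed
  have "?P \<in> primal_solutions \<epsilon> \<mu> \<nu>"
    by (simp add: primal_solutions_def primal feas P(1))
  with unique have "primal_solutions \<epsilon> \<mu> \<nu> = {?P}" by blast
  moreover have "dual_objective \<epsilon> \<mu> \<nu> f g h = dual_value \<epsilon> \<mu> \<nu>"
    by (simp only: dual dual_fgh)
  moreover have "primal_value \<epsilon> \<mu> \<nu> = dual_value \<epsilon> \<mu> \<nu>"
    by (simp only: dual primal)
  ultimately show ?thesis
    using primal fgh P(2)
    by (intro conjI exI[of _ ?P] exI[of _ f] exI[of _ g] exI[of _ h]) assumption+
qed

end

section \<open>The nondegeneracy condition and the theorem\<close>

lemma (in prob_space) integrable_of_square:
  fixes X :: "'a \<Rightarrow> 'b::euclidean_space"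
  assumes [measurable]: "X \<in> borel_measurable M" and "integrable M (\<lambda>\<omega>. (norm (X \<omega>))\<^sup>2)"
  shows "integrable M X"
proof (rule Bochner_Integration.integrable_bound)
  show "integrable M (\<lambda>\<omega>. 1 + (norm (X \<omega>))\<^sup>2)" using assms(2) by simp
  have "norm (X \<omega>) \<le> 1 + (norm (X \<omega>))\<^sup>2" for \<omega>
  proof (cases "norm (X \<omega>) \<le> 1")
    case False
    then show ?thesis using self_le_power[of "norm (X \<omega>)" 2] by simp
  qed (simp add: add_increasing2)
  then show "AE \<omega> in M. norm (X \<omega>) \<le> norm (1 + (norm (X \<omega>))\<^sup>2)" by simp
qed measurable

text \<open>If \<open>a + b \<bullet> X = 0\<close> almost surely, taking expectations gives \<open>a = 0\<close>, and then the second moment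
  matrix annihilates \<open>b\<close>.\<close>

lemma nondegenerate_of_invertible_covariance:
  fixes M :: "'w measure" and X :: "'w \<Rightarrow> real ^ 'n"
  assumes "prob_space M" and X[measurable]: "X \<in> borel_measurable M"
    and sq: "integrable M (\<lambda>\<omega>. (norm (X \<omega>))\<^sup>2)" and mean: "integral\<^sup>L M X = 0"
    and inv: "invertible (\<chi> i j. integral\<^sup>L M (\<lambda>\<omega>. X \<omega> $ i * X \<omega> $ j))"
    and ae: "AE \<omega> in M. a + b \<bullet> X \<omega> = 0"
  shows "a = 0 \<and> b = 0"
proof -
  interpret prob_space M by fact
  have X_int: "integrable M X"
    using X sq by (rule integrable_of_square)
  have "a = (\<integral>\<omega>. a + b \<bullet> X \<omega> \<partial>M)"
    using X_int mean by (simp add: prob_space)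
  also have "\<dots> = 0"
    using ae by (subst integral_cong_AE[where g = "\<lambda>_. 0"]) auto
  finally have a: "a = 0" .
  let ?S = "\<chi> i j. integral\<^sup>L M (\<lambda>\<omega>. X \<omega> $ i * X \<omega> $ j)"
  have [measurable]: "(\<lambda>\<omega>. X \<omega> $ l) \<in> borel_measurable M" for l
    by (rule measurable_compose[OF X borel_measurable_continuous_onI]) (intro continuous_intros)
  have int_ij: "integrable M (\<lambda>\<omega>. X \<omega> $ i * X \<omega> $ j)" for i j
  proof (rule Bochner_Integration.integrable_bound[OF sq])
    show "(\<lambda>\<omega>. X \<omega> $ i * X \<omega> $ j) \<in> borel_measurable M" by measurable
    show "AE \<omega> in M. norm (X \<omega> $ i * X \<omega> $ j) \<le> norm ((norm (X \<omega>))\<^sup>2)"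
      by (intro AE_I2) (auto simp: abs_mult power2_eq_square intro!: mult_mono component_le_norm_cart)
  qed
  have "?S *v b = 0"
  proof (subst vec_eq_iff, intro allI)
    fix i
    have "(?S *v b) $ i = (\<Sum>j\<in>UNIV. (\<integral>\<omega>. X \<omega> $ i * X \<omega> $ j \<partial>M) * b $ j)"
      by (simp add: matrix_vector_mult_def)
    also have "\<dots> = (\<integral>\<omega>. (\<Sum>j\<in>UNIV. X \<omega> $ i * X \<omega> $ j * b $ j) \<partial>M)"
      using int_ij by (subst Bochner_Integration.integral_sum) auto
    also have "\<dots> = (\<integral>\<omega>. 0 \<partial>M)"
    proof (rule integral_cong_AE)
      show "AE \<omega> in M. (\<Sum>j\<in>UNIV. X \<omega> $ i * X \<omega> $ j * b $ j) = 0"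
        using ae
      proof eventually_elim
        case (elim \<omega>)
        have "(\<Sum>j\<in>UNIV. X \<omega> $ i * X \<omega> $ j * b $ j) = X \<omega> $ i * (b \<bullet> X \<omega>)"
          by (simp add: inner_vec_def sum_distrib_left mult_ac)
        with elim a show ?case by simp
      qed
    qed measurable
    finally show "(?S *v b) $ i = 0 $ i" by simp
  qed
  moreover obtain B where "B ** ?S = mat 1"
    using inv unfolding invertible_def by blast
  then have "B *v (?S *v b) = b"
    by (simp only: matrix_vector_mul_assoc matrix_vector_mul_lid)
  ultimately have "b = 0"
    by (simp only: matrix_vector_mult_0_right)
  with a show ?thesis ..
qed

theorem theorem2p1:
  fixes M :: "'w measure"
    and X :: "'w \<Rightarrow> real ^ 'dx" and Y :: "'w \<Rightarrow> real ^ 'dy"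
    and \<mu> :: "(real ^ 'dy) measure"
    and \<nu> :: "((real ^ 'dx) \<times> (real ^ 'dy)) measure"
    and \<epsilon> :: real
  assumes "prob_space M"
    and "X \<in> borel_measurable M" and "Y \<in> borel_measurable M"
    and "\<nu> = distr M borel (\<lambda>\<omega>. (X \<omega>, Y \<omega>))"
    and "integrable M (\<lambda>\<omega>. (norm (X \<omega>))\<^sup>2 + (norm (Y \<omega>))\<^sup>2)"
    and "prob_space.expectation M X = 0"
    and "prob_space \<mu>" and "sets \<mu> = sets borel"
    and "integrable \<mu> (\<lambda>u. (norm u)\<^sup>2)"
    and "\<epsilon> > 0"
    and A1: "invertible (\<chi> i j. prob_space.expectation M (\<lambda>\<omega>. X \<omega> $ i * X \<omega> $ j))"
    and A2: "KL_coercive (tilted_measure \<epsilon> \<mu> \<nu>)"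
  shows "primal_value \<epsilon> \<mu> \<nu> = dual_value \<epsilon> \<mu> \<nu> \<and>
    (\<exists>\<pi>. primal_solutions \<epsilon> \<mu> \<nu> = {\<pi>} \<and>
      (\<exists>f g h. integrable \<mu> f \<and> integrable \<mu> g \<and> integrable \<nu> h \<and>
        (AE w in \<mu> \<Otimes>\<^sub>M \<nu>. RN_deriv (\<mu> \<Otimes>\<^sub>M \<nu>) \<pi> w = ennreal (gibbs_density \<epsilon> f g h w)) \<and>
        dual_objective \<epsilon> \<mu> \<nu> f g h = dual_value \<epsilon> \<mu> \<nu> \<and>
        primal_value \<epsilon> \<mu> \<nu> = ereal ((\<integral>u. f u \<partial>\<mu>) + (\<integral>z. h z \<partial>\<nu>))))"
proof -
  note [measurable] = assms(2,3)
  interpret M: prob_space M by fact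
  have XY[measurable]: "(\<lambda>\<omega>. (X \<omega>, Y \<omega>)) \<in> M \<rightarrow>\<^sub>M borel"
    by (subst borel_prod[symmetric]) measurable
  have sq: "integrable M (\<lambda>\<omega>. (norm (X \<omega>))\<^sup>2)" "integrable M (\<lambda>\<omega>. (norm (Y \<omega>))\<^sup>2)"
    by (rule Bochner_Integration.integrable_bound[OF assms(5)]; simp)+
  have X_int: "integrable M X"
    using assms(2) sq(1) by (rule M.integrable_of_square)
  have "martingale_coupling_problem \<mu> \<nu> \<epsilon>"
  proof (rule martingale_coupling_problem.intro)
    show "prob_space \<mu>" "sets \<mu> = sets borel" "integrable \<mu> (\<lambda>u. (norm u)\<^sup>2)" "\<epsilon> > 0" by fact+
    show "prob_space \<nu>" unfolding assms(4) using XY by (rule M.prob_space_distr)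
    show "sets \<nu> = sets borel" by (simp add: assms(4))
    show "integrable \<nu> (\<lambda>z. (norm (snd z))\<^sup>2)"
      unfolding assms(4) using sq by (subst integrable_distr_eq) auto
    show "integrable \<nu> fst"
      unfolding assms(4) using X_int by (subst integrable_distr_eq) auto
    show "(\<integral>z. fst z \<partial>\<nu>) = 0"
      unfolding assms(4) using assms(6) by (subst integral_distr) auto
    show "a = 0 \<and> b = 0" if "AE z in \<nu>. a + b \<bullet> fst z = 0" for a b
    proof (rule nondegenerate_of_invertible_covariance)
      show "AE \<omega> in M. a + b \<bullet> X \<omega> = 0"
        using that unfolding assms(4) by (subst (asm) AE_distr_iff) auto
    qed (use assms sq in auto)
  qed
  then show ?thesis
    by (rule martingale_coupling_problem.strong_duality_and_attainment)
qed

end
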